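(* Let $X$ and $Y$ be Banach spaces. The set of those $P\in P(^2X,Y)$ whose Aron-Berner extension $\overline P\in P(^2X^{**},Y^{**})$ attains its norm is dense in $P(^2X,Y)$.
   Context: $X$ and $Y$ are real or complex Banach spaces over the same field. $P(^2X,Y)$ is the Banach space of bounded $2$-homogeneous polynomials from $X$ into $Y$ with norm $\|P\|=\sup_{x\in B_X}\|P(x)\|$, $B_X$ being the closed unit ball. For a bounded bilinear form $T$ on $X\times X$ and $z_1,z_2\in X^{**}$ put $\overline T(z_1,z_2)=z_1\big(x_1\mapsto z_2(x_2\mapsto T(x_1,x_2))\big)$. For a bounded bilinear mapping $L:X\times X\to Y$ define $\overline L:X^{**}\times X^{**}\to Y^{**}$ by $\overline L(z_1,z_2)(y^* )=\overline{y^*\circ L}(z_1,z_2)$, $y^*\in Y^*$. If $S$ is the symmetric bilinear mapping corresponding to $P\in P(^2X,Y)$ (so $P(x)=S(x,x)$), the Aron-Berner extension of $P$ is $\overline P(z)=\overline S(z,z)$, $z\in X^{**}$. $\overline P$ attains its norm if there is $z\in B_{X^{**}}$ with $\|\overline P(z)\|=\|\overline P\|=\sup_{w\in B_{X^{**}}}\|\overline P(w)\|$. *)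

theory Defs
  imports "HOL-Analysis.Analysis"
begin

text \<open>
  The scalar field: a normed field that is a copy of the real or of the complex numbers.
\<close>

class real_or_complex = real_normed_field +
  assumes real_or_complex:
    "(\<exists>\<phi> :: 'a \<Rightarrow> real. bij \<phi> \<and> (\<forall>a b. \<phi> (a + b) = \<phi> a + \<phi> b) \<and>
        (\<forall>a b. \<phi> (a * b) = \<phi> a * \<phi> b) \<and> (\<forall>a. norm (\<phi> a) = norm a)) \<or>
     (\<exists>\<phi> :: 'a \<Rightarrow> complex. bij \<phi> \<and> (\<forall>a b. \<phi> (a + b) = \<phi> a + \<phi> b) \<and>
        (\<forall>a b. \<phi> (a * b) = \<phi> a * \<phi> b) \<and> (\<forall>a. norm (\<phi> a) = norm a))"

instance real :: real_or_complex
  by standard (intro disjI1 exI[of _ "\<lambda>x::real. x"], auto simp: bij_def)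

instance complex :: real_or_complex
  by standard (intro disjI2 exI[of _ "\<lambda>x::complex. x"], auto simp: bij_def)

text \<open>
  A Banach space over the scalar field \<open>'k\<close>: a type of class \<open>banach\<close> with a scalar
  multiplication by \<open>'k\<close> that extends the real one and is compatible with the norm.
\<close>

locale banach_over = vector_space scale
  for scale :: "'k::real_or_complex \<Rightarrow> 'a::banach \<Rightarrow> 'a" +
  assumes scale_of_real: "scale (of_real r) x = r *\<^sub>R x"
    and norm_scale: "norm (scale c x) = norm c * norm x"

lemma banach_over_scaleR: "banach_over (scaleR :: real \<Rightarrow> 'a::banach \<Rightarrow> 'a)"
  by unfold_locales (auto simp: algebra_simps)

text \<open>The dual space; its norm is \<^const>\<open>onorm\<close>.\<close>

definition dual :: "('k::real_or_complex \<Rightarrow> 'a::banach \<Rightarrow> 'a) \<Rightarrow> ('a \<Rightarrow> 'k) set" where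
  "dual s = {f. Vector_Spaces.linear s (*) f \<and> bounded_linear f}"

text \<open>
  Elements of the bidual are functions defined on the set \<open>dual s\<close>; outside of it they
  take the value \<open>undefined\<close>, so that they are determined by their values on \<open>dual s\<close>.
\<close>

definition bidual :: "('k::real_or_complex \<Rightarrow> 'a::banach \<Rightarrow> 'a) \<Rightarrow> (('a \<Rightarrow> 'k) \<Rightarrow> 'k) set" where
  "bidual s = {z \<in> extensional (dual s).
     (\<forall>f\<in>dual s. \<forall>g\<in>dual s. z (\<lambda>x. f x + g x) = z f + z g) \<and>
     (\<forall>c. \<forall>f\<in>dual s. z (\<lambda>x. c * f x) = c * z f) \<and>
     (\<exists>C. \<forall>f\<in>dual s. norm (z f) \<le> C * onorm f)}"

definition bidual_norm ::
  "('k::real_or_complex \<Rightarrow> 'a::banach \<Rightarrow> 'a) \<Rightarrow> (('a \<Rightarrow> 'k) \<Rightarrow> 'k) \<Rightarrow> real" where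
  "bidual_norm s z = (SUP f\<in>{f \<in> dual s. onorm f \<le> 1}. norm (z f))"

definition bidual_ball ::
  "('k::real_or_complex \<Rightarrow> 'a::banach \<Rightarrow> 'a) \<Rightarrow> (('a \<Rightarrow> 'k) \<Rightarrow> 'k) set" where
  "bidual_ball s = {z \<in> bidual s. bidual_norm s z \<le> 1}"

definition bilinear_over ::
  "('k::real_or_complex \<Rightarrow> 'a::banach \<Rightarrow> 'a) \<Rightarrow> ('k \<Rightarrow> 'b::banach \<Rightarrow> 'b) \<Rightarrow>
    ('a \<Rightarrow> 'a \<Rightarrow> 'b) \<Rightarrow> bool" where
  "bilinear_over sX sY L \<longleftrightarrow>
     (\<forall>x. Vector_Spaces.linear sX sY (\<lambda>y. L x y)) \<and>
     (\<forall>y. Vector_Spaces.linear sX sY (\<lambda>x. L x y))"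

definition poly2 ::
  "('k::real_or_complex \<Rightarrow> 'a::banach \<Rightarrow> 'a) \<Rightarrow> ('k \<Rightarrow> 'b::banach \<Rightarrow> 'b) \<Rightarrow> ('a \<Rightarrow> 'b) set" where
  "poly2 sX sY = {P. (\<exists>L. bilinear_over sX sY L \<and> (\<forall>x. P x = L x x)) \<and>
     bdd_above ((\<lambda>x. norm (P x)) ` cball 0 1)}"

definition poly2_norm :: "('a::banach \<Rightarrow> 'b::banach) \<Rightarrow> real" where
  "poly2_norm P = (SUP x\<in>cball 0 1. norm (P x))"

definition sym_bilinear ::
  "('k::real_or_complex \<Rightarrow> 'a::banach \<Rightarrow> 'a) \<Rightarrow> ('k \<Rightarrow> 'b::banach \<Rightarrow> 'b) \<Rightarrow>
    ('a \<Rightarrow> 'b) \<Rightarrow> 'a \<Rightarrow> 'a \<Rightarrow> 'b" where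
  "sym_bilinear sX sY P =
     (THE S. bilinear_over sX sY S \<and> (\<forall>x y. S x y = S y x) \<and> (\<forall>x. P x = S x x))"

lemma sym_bilinear_ex1:
  assumes "banach_over sX" "banach_over sY" "P \<in> poly2 sX sY"
  shows "\<exists>!S. bilinear_over sX sY S \<and> (\<forall>x y. S x y = S y x) \<and> (\<forall>x. P x = S x x)"
proof -
  interpret X: banach_over sX by fact
  interpret Y: banach_over sY by fact
  have add: "L (x + x') y = L x y + L x' y" "L x (y + y') = L x y + L x y'"
    and scale: "L (sX c x) y = sY c (L x y)" "L x (sX c y) = sY c (L x y)"
    if "bilinear_over sX sY L" for L x x' y y' c
    using that by (auto simp: bilinear_over_def Vector_Spaces.linear_iff)
  obtain L where L: "bilinear_over sX sY L" and P: "\<And>x. P x = L x x"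
    using assms(3) by (auto simp: poly2_def)
  define S where "S x y = (1/2::real) *\<^sub>R (L x y + L y x)" for x y
  have comm: "r *\<^sub>R sY c v = sY c (r *\<^sub>R v)" for r c v
    by (simp add: Y.scale_of_real [symmetric] mult.commute)
  have "bilinear_over sX sY S"
    unfolding bilinear_over_def Vector_Spaces.linear_iff S_def
    by (auto simp: add[OF L] scale[OF L] Y.scale_right_distrib [symmetric] comm
        X.vector_space_axioms Y.vector_space_axioms scaleR_add_right)
  moreover have "S x y = S y x" for x y by (simp add: S_def add.commute)
  moreover have "P x = S x x" for x
    by (simp add: S_def P scaleR_2 [symmetric])
  moreover have "S' = S" if S': "bilinear_over sX sY S'" "\<forall>x y. S' x y = S' y x"
      "\<forall>x. P x = S' x x" for S'
  proof (intro ext)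
    fix x y
    have "L (x + y) (x + y) = S' (x + y) (x + y)" "L x x = S' x x" "L y y = S' y y"
      using P S'(3) by metis+
    then have "L x y + L y x = S' x y + S' y x"
      by (simp add: add[OF L] add[OF S'(1)] add.commute)
    also have "S' y x = S' x y" using S'(2) by blast
    finally show "S' x y = S x y"
      by (simp add: S_def scaleR_2 [symmetric])
  qed
  ultimately show ?thesis by blast
qed

definition extend_form ::
  "('a \<Rightarrow> 'a \<Rightarrow> 'k) \<Rightarrow> (('a \<Rightarrow> 'k) \<Rightarrow> 'k) \<Rightarrow> (('a \<Rightarrow> 'k) \<Rightarrow> 'k) \<Rightarrow> 'k" where
  "extend_form T z\<^sub>1 z\<^sub>2 = z\<^sub>1 (\<lambda>x\<^sub>1. z\<^sub>2 (\<lambda>x\<^sub>2. T x\<^sub>1 x\<^sub>2))"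

definition extend_bilinear ::
  "('k::real_or_complex \<Rightarrow> 'b::banach \<Rightarrow> 'b) \<Rightarrow> ('a \<Rightarrow> 'a \<Rightarrow> 'b) \<Rightarrow>
    (('a \<Rightarrow> 'k) \<Rightarrow> 'k) \<Rightarrow> (('a \<Rightarrow> 'k) \<Rightarrow> 'k) \<Rightarrow> (('b \<Rightarrow> 'k) \<Rightarrow> 'k)" where
  "extend_bilinear sY L z\<^sub>1 z\<^sub>2 =
     (\<lambda>y'\<in>dual sY. extend_form (\<lambda>x\<^sub>1 x\<^sub>2. y' (L x\<^sub>1 x\<^sub>2)) z\<^sub>1 z\<^sub>2)"

definition aron_berner ::
  "('k::real_or_complex \<Rightarrow> 'a::banach \<Rightarrow> 'a) \<Rightarrow> ('k \<Rightarrow> 'b::banach \<Rightarrow> 'b) \<Rightarrow>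
    ('a \<Rightarrow> 'b) \<Rightarrow> (('a \<Rightarrow> 'k) \<Rightarrow> 'k) \<Rightarrow> (('b \<Rightarrow> 'k) \<Rightarrow> 'k)" where
  "aron_berner sX sY P z = extend_bilinear sY (sym_bilinear sX sY P) z z"

definition aron_berner_attains_norm ::
  "('k::real_or_complex \<Rightarrow> 'a::banach \<Rightarrow> 'a) \<Rightarrow> ('k \<Rightarrow> 'b::banach \<Rightarrow> 'b) \<Rightarrow>
    ('a \<Rightarrow> 'b) \<Rightarrow> bool" where
  "aron_berner_attains_norm sX sY P \<longleftrightarrow>
     (\<exists>z\<in>bidual_ball sX. bidual_norm sY (aron_berner sX sY P z) =
        (SUP w\<in>bidual_ball sX. bidual_norm sY (aron_berner sX sY P w)))"

end

theory Submission
  imports Defs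
begin

text \<open>
  The argument is of Lindenstrauss type. Let \<open>M n\<close> be the supremum of \<open>\<bar>f (A n x x)\<bar>\<close> over the
  unit balls of the dual of \<open>Y\<close> and of \<open>X\<close>, almost attained at \<open>(f n, x n)\<close>. The next bilinear
  map is obtained by adding to \<open>A n\<close> a small multiple of \<open>H n (u, v) A n (x n) (x n)\<close>, where
  \<open>H n (u, v) = W n f n (A n u v) + G n u G n v\<close> and \<open>G n u\<close> is the sum of the
  \<open>2\<^sup>k f k (A n (x n) u)\<close>, \<open>k < n\<close>, up to factors of modulus one. All later points \<open>x j\<close> must
  then almost maximize \<open>\<bar>H n (x j, x j)\<bar>\<close>. As \<open>W n\<close> is huge, they almost maximize
  \<open>\<bar>f n (A n u u)\<bar>\<close>. The derivative of \<open>f k (A n u u)\<close> at such an almost maximal point \<open>x n\<close>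
  is bounded essentially by \<open>M n\<close>, with errors summable against \<open>2\<^sup>k\<close>; hence \<open>G n\<close> can be
  almost maximal at \<open>x j\<close> only if every single \<open>\<bar>f k (A n (x n) (x j))\<bar>\<close> is at least
  \<open>M n - O(2\<^sup>-\<^sup>k)\<close>. For the limit \<open>L\<close> and \<open>k < i < j\<close> this bounds \<open>\<bar>f k (L (x i) (x j))\<bar>\<close> from
  below, so the Aron--Berner extension attains its norm at any weak* cluster point \<open>z\<close> of the
  \<open>x j\<close>: let first \<open>j\<close>, then \<open>i\<close> tend to \<open>z\<close>, and finally \<open>k\<close> to infinity. Norms in \<open>Y\<close> are
  only tested with elements of the dual ball, so that the Hahn--Banach theorem is not needed.
\<close>

section \<open>Functionals and bounded symmetric bilinear maps\<close>

definition dual_ball :: "('k::real_or_complex \<Rightarrow> 'a::banach \<Rightarrow> 'a) \<Rightarrow> ('a \<Rightarrow> 'k) set" where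
  "dual_ball s = {f \<in> dual s. onorm f \<le> 1}"

text \<open>The constant \<open>C\<close> is explicit because the iteration has to keep one bound
  valid for all its maps.\<close>

definition bounded_symmetric ::
  "('k::real_or_complex \<Rightarrow> 'a::banach \<Rightarrow> 'a) \<Rightarrow> ('k \<Rightarrow> 'b::banach \<Rightarrow> 'b) \<Rightarrow> real \<Rightarrow>
    ('a \<Rightarrow> 'a \<Rightarrow> 'b) \<Rightarrow> bool" where
  "bounded_symmetric sX sY C A \<longleftrightarrow> bilinear_over sX sY A \<and> (\<forall>x y. A x y = A y x) \<and>
     (\<forall>x y. norm (A x y) \<le> C * norm x * norm y)"

lemma bounded_symmetric_mono:
  "bounded_symmetric sX sY C A \<Longrightarrow> C \<le> D \<Longrightarrow> bounded_symmetric sX sY D A"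
  unfolding bounded_symmetric_def
  by (meson mult_right_mono norm_ge_zero order_trans)

lemma dualD:
  assumes "f \<in> dual s"
  shows dual_add: "f (x + y) = f x + f y" and dual_scale: "f (s c x) = c * f x"
    and dual_diff: "f (x - y) = f x - f y" and dual_zero: "f 0 = 0"
    and dual_scaleR: "f (r *\<^sub>R x) = of_real r * f x"
    and norm_dual_le: "norm (f x) \<le> onorm f * norm x"
proof -
  have bl: "bounded_linear f" and lin: "Vector_Spaces.linear s (*) f"
    using assms by (auto simp: dual_def)
  interpret bounded_linear f by fact
  show "f (x + y) = f x + f y" "f (x - y) = f x - f y" "f 0 = 0"
    by (auto simp: add diff zero)
  show "f (r *\<^sub>R x) = of_real r * f x"
    by (simp add: scaleR scaleR_conv_of_real)
  show "f (s c x) = c * f x"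
    using lin by (simp add: Vector_Spaces.linear_iff)
  show "norm (f x) \<le> onorm f * norm x"
    by (rule onorm[OF bl])
qed

lemma vector_space_mult: "vector_space ((*) :: 'k::field \<Rightarrow> 'k \<Rightarrow> 'k)"
  by unfold_locales (auto simp: algebra_simps)

lemma dual_ballD:
  assumes "f \<in> dual_ball s"
  shows "f \<in> dual s" and norm_dual_ball_le: "norm (f x) \<le> norm x"
proof -
  show f: "f \<in> dual s" using assms by (simp add: dual_ball_def)
  have "norm (f x) \<le> onorm f * norm x" by (rule norm_dual_le[OF f])
  also have "\<dots> \<le> 1 * norm x"
    using assms by (intro mult_right_mono) (auto simp: dual_ball_def)
  finally show "norm (f x) \<le> norm x" by simp
qed

section \<open>Functionals and the unit ball of the bidual\<close>

context banach_over begin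

lemma dualI:
  assumes "\<And>x y. f (x + y) = f x + f y" and "\<And>c x. f (scale c x) = c * f x"
    and "\<And>x. norm (f x) \<le> C * norm x"
  shows "f \<in> dual scale"
proof -
  have "Vector_Spaces.linear scale (*) f"
    unfolding Vector_Spaces.linear_iff
    using assms vector_space_axioms vector_space_mult by auto
  moreover have "bounded_linear f"
  proof (rule bounded_linear_intro[where K = C])
    fix r :: real and x
    have "f (r *\<^sub>R x) = f (scale (of_real r) x)" by (simp add: scale_of_real)
    then show "f (r *\<^sub>R x) = r *\<^sub>R f x"
      by (simp add: assms scaleR_conv_of_real)
  qed (use assms in \<open>auto simp: mult.commute\<close>)
  ultimately show ?thesis by (simp add: dual_def)
qed

lemma zero_in_dual_ball: "(\<lambda>x. 0) \<in> dual_ball scale"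
  using dualI[of "\<lambda>x. 0" 0] by (simp add: dual_ball_def onorm_zero)

text \<open>The supremum \<open>bidual_norm\<close> controls single values once the set is known to
  be bounded, which the constant in \<open>bidual\<close> provides. Normalizing \<open>f\<close> by
  \<open>onorm f\<close> gives the sharp bound; if \<open>onorm f = 0\<close>, the same constant
  already forces the value zero.\<close>

lemma bidual_ballD:
  assumes "z \<in> bidual_ball scale" and "f \<in> dual scale"
  shows bidual_add: "g \<in> dual scale \<Longrightarrow> z (\<lambda>x. f x + g x) = z f + z g"
    and bidual_mult: "z (\<lambda>x. c * f x) = c * z f"
    and norm_bidual_le: "norm (z f) \<le> onorm f"
proof -
  have z: "z \<in> bidual scale" and z1: "bidual_norm scale z \<le> 1"
    using assms(1) by (auto simp: bidual_ball_def)
  show "g \<in> dual scale \<Longrightarrow> z (\<lambda>x. f x + g x) = z f + z g"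
    and mult: "z (\<lambda>x. c * f x) = c * z f" for c
    using z assms(2) by (auto simp: bidual_def)
  obtain C where C: "\<And>f. f \<in> dual scale \<Longrightarrow> norm (z f) \<le> C * onorm f"
    using z unfolding bidual_def by blast
  have bl: "bounded_linear f" using assms(2) by (simp add: dual_def)
  have unit: "norm (z g) \<le> 1" if "g \<in> dual scale" "onorm g \<le> 1" for g
  proof -
    have "norm (z g) \<le> bidual_norm scale z"
      unfolding bidual_norm_def
    proof (rule cSUP_upper)
      show "bdd_above ((\<lambda>f. norm (z f)) ` {f \<in> dual scale. onorm f \<le> 1})"
      proof (rule bdd_aboveI2)
        fix h assume h: "h \<in> {f \<in> dual scale. onorm f \<le> 1}"
        then have "norm (z h) \<le> C * onorm h" using C by blast
        also have "\<dots> \<le> \<bar>C\<bar> * 1"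
          using h onorm_pos_le[of h] by (intro mult_mono) (auto simp: dual_def)
        finally show "norm (z h) \<le> \<bar>C\<bar> * 1" .
      qed
    qed (use that in auto)
    then show ?thesis using z1 by simp
  qed
  show "norm (z f) \<le> onorm f"
  proof (cases "onorm f = 0")
    case True
    then show ?thesis using C[OF assms(2)] by simp
  next
    case False
    then have pos: "onorm f > 0" using onorm_pos_le[OF bl] by simp
    define g where "g x = of_real (1 / onorm f) * f x" for x
    have le: "norm (g x) \<le> 1 * norm x" for x
      using norm_dual_le[OF assms(2), of x] pos
      by (simp add: g_def norm_mult norm_divide field_simps)
    have "g \<in> dual scale"
      by (rule dualI[OF _ _ le]) (auto simp: g_def dual_add[OF assms(2)] dual_scale[OF assms(2)] algebra_simps add_divide_distrib)
    moreover have "onorm g \<le> 1"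
      by (rule onorm_bound) (use le in auto)
    ultimately have "norm (z g) \<le> 1" by (rule unit)
    also have "z g = of_real (1 / onorm f) * z f"
      unfolding g_def by (rule mult)
    finally show ?thesis using pos by (simp add: norm_mult norm_divide field_simps)
  qed
qed

text \<open>Goldstine's theorem for a single functional, with error one. As
  \<open>norm (w g) \<le> onorm g\<close>, some \<open>u\<close> in the ball satisfies
  \<open>norm (g u) > norm (w g) - 1\<close>; a scalar multiple of \<open>u\<close> then gives the
  value the right argument.\<close>

lemma bidual_approx:
  assumes "w \<in> bidual_ball scale" and "g \<in> dual scale"
  obtains x where "norm x \<le> 1" and "norm (g x - w g) \<le> 1"
proof (cases "norm (w g) \<le> 1")
  case True
  then show ?thesis using that[of 0] by (simp add: dual_zero[OF assms(2)])
next
  case False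
  have "\<exists>u. norm u \<le> 1 \<and> norm (g u) > norm (w g) - 1"
  proof (rule ccontr)
    assume "\<not> ?thesis"
    then have *: "norm (g u) \<le> norm (w g) - 1" if "norm u \<le> 1" for u
      using that by force
    have "onorm g \<le> norm (w g) - 1"
    proof (rule onorm_bound)
      show "0 \<le> norm (w g) - 1" using False by simp
      fix u
      show "norm (g u) \<le> (norm (w g) - 1) * norm u"
      proof (cases "u = 0")
        case True
        then show ?thesis by (simp add: dual_zero[OF assms(2)])
      next
        case False
        have "norm (g ((1 / norm u) *\<^sub>R u)) \<le> norm (w g) - 1"
          by (rule *) (use False in simp)
        then show ?thesis
          using False by (simp add: dual_scaleR[OF assms(2)] norm_mult norm_divide field_simps)
      qed
    qed
    then show False using norm_bidual_le[OF assms] by simp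
  qed
  then obtain u where u: "norm u \<le> 1" "norm (g u) > norm (w g) - 1" by blast
  then have gu: "g u \<noteq> 0" using False by auto
  \<comment> \<open>\<open>c\<close> turns \<open>g u\<close> into the direction of
    \<open>w g\<close>. The minimum keeps \<open>norm c \<le> 1\<close> and prevents overshooting,
    so the error is the deficit of \<open>norm (g u)\<close>, if any.\<close>
  define c where "c = of_real (min (norm (g u)) (norm (w g))) / of_real (norm (w g)) * w g / g u"
  have wg: "w g \<noteq> 0" using False by auto
  have "norm c = min (norm (g u)) (norm (w g)) / norm (g u)"
    using wg by (simp add: c_def norm_mult norm_divide)
  also have "\<dots> \<le> 1" using gu by (simp add: field_simps)
  finally have "norm c \<le> 1" .
  then have "norm (scale c u) \<le> 1"
    using u(1) by (simp add: norm_scale mult_le_one)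
  moreover have "g (scale c u) - w g =
      of_real (min (norm (g u)) (norm (w g)) / norm (w g) - 1) * w g"
    using gu by (simp add: dual_scale[OF assms(2)] c_def algebra_simps)
  then have "norm (g (scale c u) - w g) = \<bar>min (norm (g u)) (norm (w g)) - norm (w g)\<bar>"
    using wg by (simp add: norm_mult abs_mult [symmetric] field_simps del: of_real_diff of_real_divide)
  then have "norm (g (scale c u) - w g) \<le> 1"
    using u(2) by (auto simp: min_def split: if_splits)
  ultimately show ?thesis by (rule that)
qed

end

section \<open>Scalar forms and their iterated extension to the bidual\<close>

locale banach_pair = X: banach_over sX + Y: banach_over sY
  for sX :: "'k::real_or_complex \<Rightarrow> 'a::banach \<Rightarrow> 'a"
    and sY :: "'k \<Rightarrow> 'b::banach \<Rightarrow> 'b"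
begin

lemma bilinearD:
  assumes "bilinear_over sX sY A"
  shows "A (x + x') y = A x y + A x' y" "A x (y + y') = A x y + A x y'"
    and "A (sX c x) y = sY c (A x y)" "A x (sX c y) = sY c (A x y)"
  using assms by (auto simp: bilinear_over_def Vector_Spaces.linear_iff)

lemma bilinearI:
  assumes "\<And>x x' y. A (x + x') y = A x y + A x' y"
    and "\<And>x y y'. A x (y + y') = A x y + A x y'"
    and "\<And>c x y. A (sX c x) y = sY c (A x y)" and "\<And>c x y. A x (sX c y) = sY c (A x y)"
  shows "bilinear_over sX sY A"
  unfolding bilinear_over_def Vector_Spaces.linear_iff
  using assms X.vector_space_axioms Y.vector_space_axioms by blast

lemma bounded_symmetricD:
  assumes "bounded_symmetric sX sY C A"
  shows "A x y = A y x" and "norm (A x y) \<le> C * norm x * norm y"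
    and "A (x + x') y = A x y + A x' y" "A x (y + y') = A x y + A x y'"
    and "A (sX c x) y = sY c (A x y)" "A x (sX c y) = sY c (A x y)"
  using assms bilinearD unfolding bounded_symmetric_def by blast+

lemma norm_bounded_symmetric_le:
  assumes "bounded_symmetric sX sY C A" "norm x \<le> 1" "norm y \<le> 1" "0 \<le> C"
  shows "norm (A x y) \<le> C"
proof -
  have "norm (A x y) \<le> C * norm x * norm y" by (rule bounded_symmetricD[OF assms(1)])
  also have "\<dots> \<le> C * 1 * 1" using assms by (intro mult_mono) auto
  finally show ?thesis by simp
qed

context
  fixes A C f
  assumes A: "bounded_symmetric sX sY C A" and f: "f \<in> dual sY"
begin

lemma form_simps:
  "f (A (x + x') y) = f (A x y) + f (A x' y)" "f (A x (y + y')) = f (A x y) + f (A x y')"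
  "f (A (sX c x) y) = c * f (A x y)" "f (A x (sX c y)) = c * f (A x y)"
  by (simp_all add: bounded_symmetricD[OF A] dual_add[OF f] dual_scale[OF f])

lemma norm_form_le: "norm (f (A x y)) \<le> \<bar>onorm f * C\<bar> * norm x * norm y"
proof -
  have "norm (f (A x y)) \<le> onorm f * norm (A x y)" by (rule norm_dual_le[OF f])
  also have "\<dots> \<le> onorm f * (C * norm x * norm y)"
    using f onorm_pos_le[of f] by (intro mult_left_mono bounded_symmetricD[OF A]) (auto simp: dual_def)
  also have "\<dots> \<le> \<bar>onorm f * C\<bar> * norm x * norm y"
    by (simp add: mult.assoc [symmetric] mult_right_mono)
  finally show ?thesis .
qed

lemma form_dual: "(\<lambda>y. f (A x y)) \<in> dual sX"
  by (rule X.dualI[where C = "\<bar>onorm f * C\<bar> * norm x"]) (auto simp: form_simps norm_form_le)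

text \<open>Elements of the bidual have meaningful values only on \<open>dual sX\<close>, so the
  outer application in the extension requires the inner one to produce a functional.\<close>

lemma form_dual_bidual:
  assumes w: "w \<in> bidual_ball sX"
  shows "(\<lambda>x. w (\<lambda>y. f (A x y))) \<in> dual sX"
proof (rule X.dualI[where C = "\<bar>onorm f * C\<bar>"])
  fix x x' c
  show "w (\<lambda>y. f (A (x + x') y)) = w (\<lambda>y. f (A x y)) + w (\<lambda>y. f (A x' y))"
    unfolding form_simps by (intro X.bidual_add[OF w] form_dual)
  show "w (\<lambda>y. f (A (sX c x) y)) = c * w (\<lambda>y. f (A x y))"
    unfolding form_simps by (intro X.bidual_mult[OF w] form_dual)
  have "norm (w (\<lambda>y. f (A x y))) \<le> onorm (\<lambda>y. f (A x y))"
    by (intro X.norm_bidual_le[OF w] form_dual)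
  also have "\<dots> \<le> \<bar>onorm f * C\<bar> * norm x"
    by (rule onorm_bound) (auto simp: norm_form_le)
  finally show "norm (w (\<lambda>y. f (A x y))) \<le> \<bar>onorm f * C\<bar> * norm x" .
qed

lemma form_scale: "f (A (r *\<^sub>R x) (r *\<^sub>R x)) = of_real (r^2) * f (A x x)"
  unfolding X.scale_of_real [symmetric] by (simp add: form_simps power2_eq_square)

lemma form_quadratic_le:
  assumes "\<And>x. norm x \<le> 1 \<Longrightarrow> norm (f (A x x)) \<le> M"
  shows "norm (f (A x x)) \<le> M * (norm x)\<^sup>2"
proof (cases "x = 0")
  case True
  then show ?thesis using norm_form_le[of x x] by simp
next
  case False
  have "norm (f (A ((1 / norm x) *\<^sub>R x) ((1 / norm x) *\<^sub>R x))) \<le> M"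
    by (rule assms) (use False in simp)
  then show ?thesis
    unfolding form_scale using False by (simp add: norm_mult norm_divide norm_power field_simps)
qed

text \<open>
  The Davie--Gamelin estimate. In \<open>N\<^sup>2\<close> times the value at \<open>(w, w)\<close>, regarded as the value
  of the form at \<open>(N w, N w)\<close>, the copies of \<open>w\<close> are replaced by elements of the unit ball
  of the space one by one. Each replacement costs a bounded amount, since only one
  functional has to be approximated.
\<close>

lemma norm_extension_le:
  assumes w: "w \<in> bidual_ball sX" and M: "\<And>x. norm x \<le> 1 \<Longrightarrow> norm (f (A x x)) \<le> M"
  shows "norm (w (\<lambda>x. w (\<lambda>y. f (A x y)))) \<le> M"
proof -
  define T where "T x y = f (A x y)" for x y
  define \<phi> where "\<phi> x = w (T x)" for x
  define l where "l = w \<phi>"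
  define K where "K = M + norm l + 2"
  have T_dual: "T x \<in> dual sX" for x
    using form_dual[of x] by (simp add: T_def [abs_def])
  have \<phi>_dual: "\<phi> \<in> dual sX"
    using form_dual_bidual[OF w] by (simp add: T_def [abs_def] \<phi>_def [abs_def])
  have T_sym: "T x y = T y x" for x y
    using bounded_symmetricD(1)[OF A] by (simp add: T_def)
  have T_add: "T (x + x') y = T x y + T x' y" "T x (y + y') = T x y + T x y'" for x x' y y'
    by (simp_all add: T_def form_simps)
  \<comment> \<open>The sum \<open>T s s + 2 * of_nat p * \<phi> s + of_nat p ^ 2 * l\<close> stands
    for the extended form at \<open>s + p w\<close>: out of \<open>p + m\<close> copies of
    \<open>w\<close>, \<open>m\<close> have been replaced by vectors of the ball with sum
    \<open>s\<close>.\<close>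
  have step: "\<exists>s. norm s \<le> real m \<and>
      norm (T s s + 2 * of_nat p * \<phi> s + of_nat p ^ 2 * l - of_nat (p + m) ^ 2 * l) \<le> real m * K" for p m
  proof (induction m arbitrary: p)
    case 0
    show ?case
      by (rule exI[of _ 0]) (use norm_form_le[of 0 0] in \<open>simp add: T_def dual_zero[OF \<phi>_dual]\<close>)
  next
    case (Suc m)
    obtain s where s: "norm s \<le> real m" and
      q: "norm (T s s + 2 * of_nat (Suc p) * \<phi> s + of_nat (Suc p) ^ 2 * l - of_nat (Suc p + m) ^ 2 * l) \<le> real m * K"
      using Suc.IH[of "Suc p"] by blast
    \<comment> \<open>\<open>g\<close> is the extended form with one argument fixed at
      \<open>s + p w\<close>. Exchanging one further \<open>w\<close> for \<open>x\<close> changes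
      the value by \<open>2 * (g x - w g)\<close> and the difference \<open>T x x - l\<close>, which
      explains the constant \<open>K\<close>.\<close>
    define g where "g y = T s y + of_nat p * \<phi> y" for y
    have p\<phi>: "(\<lambda>y. of_nat p * \<phi> y) \<in> dual sX"
      by (rule X.dualI[where C = "real p * onorm \<phi>"])
        (use norm_dual_le[OF \<phi>_dual] in \<open>auto simp: dual_add[OF \<phi>_dual] dual_scale[OF \<phi>_dual] algebra_simps norm_mult mult_left_mono\<close>)
    have g: "g \<in> dual sX"
      by (rule X.dualI[where C = "onorm (T s) + real p * onorm \<phi>"])
        (use norm_dual_le[OF \<phi>_dual] norm_dual_le[OF T_dual] in
         \<open>auto simp: g_def dual_add[OF \<phi>_dual] dual_scale[OF \<phi>_dual] dual_add[OF T_dual] dual_scale[OF T_dual]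
           algebra_simps norm_mult intro!: norm_triangle_le add_mono mult_left_mono\<close>)
    have wg: "w g = \<phi> s + of_nat p * l"
      using X.bidual_add[OF w T_dual p\<phi>] X.bidual_mult[OF w \<phi>_dual]
      by (simp add: g_def [abs_def] \<phi>_def l_def)
    obtain x where x: "norm x \<le> 1" "norm (g x - w g) \<le> 1"
      using X.bidual_approx[OF w g] by blast
    have \<phi>_add: "\<phi> (s + x) = \<phi> s + \<phi> x" by (rule dual_add[OF \<phi>_dual])
    have "T (s + x) (s + x) + 2 * of_nat p * \<phi> (s + x) + of_nat p ^ 2 * l - of_nat (p + Suc m) ^ 2 * l
      = (T s s + 2 * of_nat (Suc p) * \<phi> s + of_nat (Suc p) ^ 2 * l - of_nat (Suc p + m) ^ 2 * l)
        + (2 * (g x - w g) + (T x x - l))"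
      unfolding wg \<phi>_add T_add g_def T_sym[of x s]
      by (simp add: algebra_simps power2_eq_square)
    also have "norm \<dots> \<le> real m * K + (2 * 1 + (M + norm l))"
    proof (intro norm_triangle_mono q)
      show "norm (2 * (g x - w g)) \<le> 2 * 1" using x(2) by (simp add: norm_mult del: right_diff_distrib_numeral)
      show "norm (T x x - l) \<le> M + norm l"
        using norm_triangle_ineq4[of "T x x" l] M[OF x(1)] by (simp add: T_def)
    qed
    also have "\<dots> = real (Suc m) * K" by (simp add: K_def algebra_simps)
    finally have "norm (T (s + x) (s + x) + 2 * of_nat p * \<phi> (s + x) + of_nat p ^ 2 * l - of_nat (p + Suc m) ^ 2 * l)
      \<le> real (Suc m) * K" .
    moreover have "norm (s + x) \<le> real (Suc m)"
      using norm_triangle_ineq[of s x] s x(1) by simp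
    ultimately show ?case by blast
  qed
  \<comment> \<open>With all \<open>Suc m\<close> copies replaced, the form is at most
    \<open>M\<close> times the square of \<open>Suc m\<close>, while the error is only linear in
    \<open>Suc m\<close>.\<close>
  have bound: "norm l \<le> M + K / real (Suc m)" for m
  proof -
    let ?m = "real (Suc m)"
    obtain s where s: "norm s \<le> ?m" "norm (T s s - of_nat (Suc m) ^ 2 * l) \<le> ?m * K"
      using step[of "Suc m" 0] by auto
    have "0 \<le> M" using M[of 0] norm_ge_zero order_trans by (metis norm_zero zero_le_one)
    have "norm (T s s) \<le> M * (norm s)\<^sup>2" unfolding T_def by (rule form_quadratic_le[OF M])
    also have "\<dots> \<le> M * ?m\<^sup>2"
      using s(1) \<open>0 \<le> M\<close> by (intro mult_left_mono power_mono) auto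
    finally have "norm (of_nat (Suc m) ^ 2 * l) \<le> M * ?m\<^sup>2 + ?m * K"
      using norm_triangle_ineq4[of "T s s" "T s s - of_nat (Suc m) ^ 2 * l"] s(2) by simp
    then have "?m * (?m * norm l) \<le> ?m * (M * ?m + K)"
      by (simp only: norm_mult norm_power norm_of_nat) (simp add: power2_eq_square algebra_simps)
    then have "?m * norm l \<le> M * ?m + K"
      by (rule mult_left_le_imp_le) simp
    then show ?thesis by (simp add: field_simps)
  qed
  have "(\<lambda>m. M + K / real (Suc m)) \<longlonglongrightarrow> M + 0"
    by (intro tendsto_intros LIMSEQ_Suc[OF lim_const_over_n])
  then have "norm l \<le> M + 0"
    by (rule LIMSEQ_le_const) (use bound in blast)
  then show ?thesis by (simp add: l_def \<phi>_def [abs_def] T_def [abs_def])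
qed

end

end

section \<open>Weak* cluster points\<close>

text \<open>The scalar field is given only up to an isometric isomorphism, so compactness is
  transported from a Euclidean ball; additivity and preservation of norms make \<open>\<phi>\<close>
  preserve distances.\<close>

lemma compact_cball_isometry:
  fixes \<phi> :: "'k::real_normed_vector \<Rightarrow> 'c::euclidean_space"
  assumes \<phi>: "bij \<phi>" "\<And>a b. \<phi> (a + b) = \<phi> a + \<phi> b" "\<And>a. norm (\<phi> a) = norm a"
  shows "compact (cball (0 :: 'k) r)"
proof -
  have dist: "dist (\<phi> a) (\<phi> b) = dist a b" for a b
    using \<phi>(2)[of "a - b" b] \<phi>(3)[of "a - b"] by (simp add: dist_norm algebra_simps)
  have "continuous_on (cball 0 r) (inv \<phi>)"
    unfolding continuous_on_iff
    using dist \<phi>(1) by (metis bij_inv_eq_iff)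
  then have "compact (inv \<phi> ` cball 0 r)"
    by (intro compact_continuous_image compact_cball)
  also have "inv \<phi> ` cball 0 r = cball 0 r"
  proof (intro equalityI subsetI)
    fix a assume "a \<in> inv \<phi> ` cball 0 r"
    then show "a \<in> cball 0 r"
      using \<phi>(1,3) by (auto simp: bij_def) (metis surj_f_inv_f)
  next
    fix a :: 'k assume "a \<in> cball 0 r"
    then show "a \<in> inv \<phi> ` cball 0 r"
      using \<phi>(1,3) by (auto simp: bij_def intro!: image_eqI[of _ _ "\<phi> a"])
  qed
  finally show ?thesis .
qed

lemma compact_cball_scalar: "compact (cball (0 :: 'k::real_or_complex) r)"
  using real_or_complex[where 'a = 'k]
  by (elim disjE exE conjE) (erule compact_cball_isometry; simp)+

text \<open>Banach--Alaoglu: the evaluations at the \<open>x n\<close> lie in a product of compact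
  discs and cluster there by Tychonoff's theorem. A filter takes the place of a subsequence, since
  such a product need not be sequentially compact.\<close>

lemma (in banach_over) bidual_cluster_point:
  fixes x :: "nat \<Rightarrow> 'a"
  assumes x: "\<And>n. norm (x n) \<le> 1"
  obtains F :: "nat filter" and z where "F \<noteq> bot" and "F \<le> sequentially"
    and "z \<in> bidual_ball scale"
    and "\<And>f. f \<in> dual scale \<Longrightarrow> ((\<lambda>n. f (x n)) \<longlongrightarrow> z f) F"
proof -
  \<comment> \<open>The product runs over all functions, so that it carries the product topology of
    the type; coordinates outside \<open>dual scale\<close> are frozen at zero.\<close>
  define K :: "(('a \<Rightarrow> 'k) \<Rightarrow> 'k) set"
    where "K = (\<Pi>\<^sub>E f\<in>UNIV. cball 0 (if f \<in> dual scale then onorm f else 0))"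
  define e where "e n f = (if f \<in> dual scale then f (x n) else 0)" for n f
  have "compactin (product_topology (\<lambda>_. euclidean) UNIV) K"
    by (simp add: K_def compactin_PiE compact_cball_scalar)
  then have "compact K"
    by (simp add: euclidean_product_topology)
  have norm_e: "norm (f (x n)) \<le> onorm f" if "f \<in> dual scale" for f n
  proof -
    have "norm (f (x n)) \<le> onorm f * norm (x n)" by (rule norm_dual_le[OF that])
    also have "\<dots> \<le> onorm f * 1"
      using that x onorm_pos_le[of f] by (intro mult_left_mono) (auto simp: dual_def)
    finally show ?thesis by simp
  qed
  have "e n \<in> K" for n
    using norm_e by (auto simp: K_def e_def)
  then have "\<exists>z0\<in>K. inf (nhds z0) (filtermap e sequentially) \<noteq> bot"
    using \<open>compact K\<close> unfolding compact_filter
    by (auto simp: filtermap_bot_iff eventually_filtermap)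
  then obtain z0 where ne: "inf (nhds z0) (filtermap e sequentially) \<noteq> bot" by blast
  \<comment> \<open>Along \<open>F\<close> the indices tend to infinity and \<open>e\<close>
    converges to \<open>z0\<close>; \<open>F\<close> is proper because \<open>z0\<close> is a
    cluster point.\<close>
  define F where "F = inf (filtercomap e (nhds z0)) sequentially"
  have "F \<noteq> bot"
  proof
    assume "F = bot"
    then have "eventually (\<lambda>_. False) (inf (filtercomap e (nhds z0)) sequentially)"
      by (simp add: F_def)
    then obtain P Q where "eventually P (filtercomap e (nhds z0))" and Q: "eventually Q sequentially"
      and PQ: "\<And>n. P n \<Longrightarrow> Q n \<Longrightarrow> False"
      unfolding eventually_inf by blast
    then obtain P' where P': "eventually P' (nhds z0)" "\<And>n. P' (e n) \<Longrightarrow> P n"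
      unfolding eventually_filtercomap by blast
    have "eventually (\<lambda>n. \<not> P' (e n)) sequentially"
      using Q by eventually_elim (use P' PQ in blast)
    then have "eventually (\<lambda>w. \<not> P' w) (filtermap e sequentially)"
      by (simp add: eventually_filtermap)
    then have "eventually (\<lambda>_. False) (inf (nhds z0) (filtermap e sequentially))"
      unfolding eventually_inf using P'(1) by blast
    then show False using ne by (simp add: trivial_limit_def)
  qed
  have e_lim: "filterlim e (nhds z0) F"
    unfolding F_def by (rule filterlim_mono[OF filterlim_filtercomap order_refl]) simp
  have lim_e: "((\<lambda>n. e n f) \<longlongrightarrow> z0 f) F" for f
    by (rule continuous_on_tendsto_compose[OF continuous_on_product_coordinates[of f] e_lim]) simp_all
  have lim: "((\<lambda>n. f (x n)) \<longlongrightarrow> z0 f) F" if "f \<in> dual scale" for f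
    using lim_e[of f] that by (simp add: e_def)
  define z where "z = restrict z0 (dual scale)"
  have zlim: "((\<lambda>n. f (x n)) \<longlongrightarrow> z f) F" if "f \<in> dual scale" for f
    using lim[OF that] that by (simp add: z_def)
  have z_le: "norm (z f) \<le> onorm f" if "f \<in> dual scale" for f
    using tendsto_upperbound[OF tendsto_norm[OF zlim[OF that]], of "onorm f"] norm_e[OF that] \<open>F \<noteq> bot\<close>
    by simp
  have z_add: "z (\<lambda>x. f x + g x) = z f + z g" if f: "f \<in> dual scale" and g: "g \<in> dual scale" for f g
  proof (rule tendsto_unique[OF \<open>F \<noteq> bot\<close>])
    have "(\<lambda>x. f x + g x) \<in> dual scale"
      by (rule dualI[where C = "onorm f + onorm g"])
        (use f g in \<open>auto simp: dual_add dual_scale algebra_simps intro!: norm_triangle_le add_mono norm_dual_le\<close>)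
    then show "((\<lambda>n. f (x n) + g (x n)) \<longlongrightarrow> z (\<lambda>x. f x + g x)) F" by (rule zlim)
    show "((\<lambda>n. f (x n) + g (x n)) \<longlongrightarrow> z f + z g) F"
      by (intro tendsto_add zlim f g)
  qed
  have z_mult: "z (\<lambda>x. c * f x) = c * z f" if f: "f \<in> dual scale" for c f
  proof (rule tendsto_unique[OF \<open>F \<noteq> bot\<close>])
    have "(\<lambda>x. c * f x) \<in> dual scale"
    proof (rule dualI[where C = "norm c * onorm f"])
      show "norm (c * f x) \<le> norm c * onorm f * norm x" for x
        using norm_dual_le[OF f, of x] by (simp add: norm_mult mult.assoc mult_left_mono)
    qed (simp_all add: dual_add[OF f] dual_scale[OF f] distrib_left mult.left_commute)
    then show "((\<lambda>n. c * f (x n)) \<longlongrightarrow> z (\<lambda>x. c * f x)) F" by (rule zlim)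
    show "((\<lambda>n. c * f (x n)) \<longlongrightarrow> c * z f) F"
      by (intro tendsto_mult tendsto_const zlim f)
  qed
  have "z \<in> bidual scale"
    unfolding bidual_def using z_add z_mult z_le by (auto simp: z_def intro: exI[of _ 1])
  moreover have "bidual_norm scale z \<le> 1"
    unfolding bidual_norm_def
  proof (rule cSUP_least)
    show "{f \<in> dual scale. onorm f \<le> 1} \<noteq> {}"
      using zero_in_dual_ball by (auto simp: dual_ball_def)
  qed (use z_le order_trans in blast)
  ultimately have "z \<in> bidual_ball scale" by (simp add: bidual_ball_def)
  moreover have "F \<le> sequentially" by (simp add: F_def)
  ultimately show ?thesis using that \<open>F \<noteq> bot\<close> zlim by blast
qed

section \<open>The norm of the Aron--Berner extension\<close>

context banach_pair begin

text \<open>The norm of the polynomial given by \<open>A\<close>, measured through scalar forms: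
  these are what the iteration maximizes and what the norm in the bidual of \<open>Y\<close>
  sees.\<close>

definition poly_sup :: "('a \<Rightarrow> 'a \<Rightarrow> 'b) \<Rightarrow> real" where
  "poly_sup A = (SUP (f, x)\<in>dual_ball sY \<times> cball 0 1. norm (f (A x x)))"

lemma poly_sup_bdd:
  assumes "bounded_symmetric sX sY C A"
  shows "bdd_above ((\<lambda>(f, x). norm (f (A x x))) ` (dual_ball sY \<times> cball 0 1))"
proof (rule bdd_aboveI2)
  fix p assume "p \<in> dual_ball sY \<times> cball (0::'a) 1"
  then obtain f x where p: "p = (f, x)" "f \<in> dual_ball sY" "norm x \<le> 1" by auto
  have A: "bounded_symmetric sX sY \<bar>C\<bar> A" using assms by (rule bounded_symmetric_mono) simp
  have "norm (f (A x x)) \<le> norm (A x x)" by (rule norm_dual_ball_le[OF p(2)])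
  also have "\<dots> \<le> \<bar>C\<bar>" using norm_bounded_symmetric_le[OF A] p by simp
  finally show "(case p of (f, x) \<Rightarrow> norm (f (A x x))) \<le> \<bar>C\<bar>" by (simp add: p)
qed

lemma poly_sup_upper:
  assumes "bounded_symmetric sX sY C A" "f \<in> dual_ball sY" "norm x \<le> 1"
  shows "norm (f (A x x)) \<le> poly_sup A"
  unfolding poly_sup_def
  using cSUP_upper[OF _ poly_sup_bdd[OF assms(1)], of "(f, x)"] assms by simp

lemma poly_sup_least:
  assumes "\<And>f x. f \<in> dual_ball sY \<Longrightarrow> norm x \<le> 1 \<Longrightarrow> norm (f (A x x)) \<le> M"
  shows "poly_sup A \<le> M"
  unfolding poly_sup_def
  by (rule cSUP_least) (use Y.zero_in_dual_ball assms in \<open>auto\<close>)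

lemma poly_sup_approx:
  assumes "e > 0"
  obtains f x where "f \<in> dual_ball sY" "norm x \<le> 1" "norm (f (A x x)) > poly_sup A - e"
proof (rule ccontr)
  assume "\<not> thesis"
  then have "poly_sup A \<le> poly_sup A - e"
    using that by (intro poly_sup_least) force
  then show False using assms by simp
qed

lemma poly_sup_diff:
  assumes "bounded_symmetric sX sY C B"
    and "\<And>x. norm x \<le> 1 \<Longrightarrow> norm (A x x - B x x) \<le> d"
  shows "poly_sup A \<le> poly_sup B + d"
proof (rule poly_sup_least)
  fix f and x :: 'a assume f: "f \<in> dual_ball sY" and x: "norm x \<le> 1"
  have "f (A x x) = f (B x x) + f (A x x - B x x)"
    using dual_diff[OF dual_ballD(1)[OF f]] by simp
  also have "norm \<dots> \<le> poly_sup B + d"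
    by (intro norm_triangle_mono poly_sup_upper[OF assms(1) f x]
        order_trans[OF norm_dual_ball_le[OF f] assms(2)[OF x]])
  finally show "norm (f (A x x)) \<le> poly_sup B + d" .
qed

text \<open>By uniqueness \<open>A\<close> is the symmetric map of \<open>Q\<close>. The
  Davie--Gamelin estimate bounds the extension by \<open>poly_sup A\<close> on the whole bidual
  ball, and \<open>att\<close> says that this bound is reached at \<open>z\<close>.\<close>

lemma aron_berner_attains_normI:
  assumes Q: "Q \<in> poly2 sX sY" and QA: "\<And>x. Q x = A x x"
    and A: "bounded_symmetric sX sY C A" and z: "z \<in> bidual_ball sX"
    and att: "\<And>e. e > 0 \<Longrightarrow> \<exists>f\<in>dual_ball sY. norm (z (\<lambda>x. z (\<lambda>y. f (A x y)))) \<ge> poly_sup A - e"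
  shows "aron_berner_attains_norm sX sY Q"
proof -
  have "sym_bilinear sX sY Q = A"
    unfolding sym_bilinear_def
    by (rule the1_equality[OF sym_bilinear_ex1[OF X.banach_over_axioms Y.banach_over_axioms Q]])
      (use A QA in \<open>auto simp: bounded_symmetric_def\<close>)
  then have AB: "aron_berner sX sY Q w f = w (\<lambda>x. w (\<lambda>y. f (A x y)))" if "f \<in> dual_ball sY" for w f
    using dual_ballD(1)[OF that] by (simp add: aron_berner_def extend_bilinear_def extend_form_def)
  have upper: "norm (aron_berner sX sY Q w f) \<le> poly_sup A"
    if "w \<in> bidual_ball sX" "f \<in> dual_ball sY" for w f
    unfolding AB[OF that(2)]
    by (rule norm_extension_le[OF A dual_ballD(1)[OF that(2)] that(1)]) (rule poly_sup_upper[OF A that(2)])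
  have ne: "dual_ball sY \<noteq> {}" using Y.zero_in_dual_ball by blast
  have le: "bidual_norm sY (aron_berner sX sY Q w) \<le> poly_sup A" if "w \<in> bidual_ball sX" for w
    unfolding bidual_norm_def dual_ball_def [symmetric]
    by (rule cSUP_least[OF ne]) (rule upper[OF that])
  have ge: "poly_sup A \<le> bidual_norm sY (aron_berner sX sY Q z)"
  proof (rule field_le_epsilon)
    fix e :: real assume "e > 0"
    then obtain f where f: "f \<in> dual_ball sY" "norm (aron_berner sX sY Q z f) \<ge> poly_sup A - e"
      using att AB by metis
    have "norm (aron_berner sX sY Q z f) \<le> bidual_norm sY (aron_berner sX sY Q z)"
      unfolding bidual_norm_def dual_ball_def [symmetric]
      by (rule cSUP_upper[OF f(1)]) (rule bdd_aboveI2, rule upper[OF z])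
    then show "poly_sup A \<le> bidual_norm sY (aron_berner sX sY Q z) + e" using f(2) by simp
  qed
  have "(SUP w\<in>bidual_ball sX. bidual_norm sY (aron_berner sX sY Q w)) = bidual_norm sY (aron_berner sX sY Q z)"
    by (rule cSup_eq_maximum) (use z le ge order_trans in \<open>blast+\<close>)
  then show ?thesis
    unfolding aron_berner_attains_norm_def using z by metis
qed

end

section \<open>The perturbations\<close>

text \<open>The factor of modulus one that rotates \<open>a\<close> to \<open>norm a\<close>; the
  value 1 at zero keeps the modulus equal to one without exception.\<close>

definition phase :: "'k::real_normed_field \<Rightarrow> 'k" where
  "phase a = (if a = 0 then 1 else of_real (norm a) / a)"

lemma norm_phase [simp]: "norm (phase a) = 1"
  by (simp add: phase_def norm_divide)

lemma phase_nonzero [simp]: "phase a \<noteq> 0"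
  by (simp add: phase_def)

lemma phase_mult [simp]: "phase a * a = of_real (norm a)"
  by (simp add: phase_def)

context banach_pair begin

text \<open>
  Since the point \<open>x\<close> almost maximizes the form, comparison with the points
  \<open>(1 - t) x + t c y\<close>, \<open>c\<close> of modulus one, bounds the derivative at \<open>x\<close>.
\<close>

lemma norm_form_at_near_maximum:
  assumes A: "bounded_symmetric sX sY C A" and f: "f \<in> dual sY"
    and M: "\<And>x. norm x \<le> 1 \<Longrightarrow> norm (f (A x x)) \<le> M" "M \<le> R"
    and x: "norm x \<le> 1" and y: "norm y \<le> 1"
    and t: "0 < t" "t \<le> 1/4"
    and near: "M - 4 * R * t\<^sup>2 \<le> norm (f (A x x))"
  shows "norm (f (A x y)) \<le> M + 4 * R * t"
proof -
  note simps = form_simps[OF A f]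
  \<comment> \<open>\<open>p\<close> and \<open>c\<close> make the contributions of
    \<open>(x, x)\<close> and \<open>(x, y)\<close> nonnegative reals, so that these two cannot
    cancel.\<close>
  define p where "p = phase (f (A x x))"
  define c where "c = phase (f (A x y)) / p"
  define z where "z = sX (of_real (1 - t)) x + sX (of_real t * c) y"
  have p: "norm p = 1" "p \<noteq> 0" by (simp_all add: p_def)
  have c: "norm c = 1" by (simp add: c_def norm_divide p)
  have "norm z \<le> \<bar>1 - t\<bar> * norm x + \<bar>t\<bar> * norm y"
    unfolding z_def
    by (rule order_trans[OF norm_triangle_ineq])
      (simp only: X.norm_scale norm_mult c norm_of_real mult_1_right order_refl)
  also have "\<dots> \<le> \<bar>1 - t\<bar> * 1 + \<bar>t\<bar> * 1"
    using x y by (intro add_mono mult_left_mono) auto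
  finally have "norm z \<le> 1" using t by simp
  have sym: "f (A y x) = f (A x y)" using bounded_symmetricD(1)[OF A] by metis
  have "p * f (A z z) = of_real ((1 - t)\<^sup>2) * (p * f (A x x))
      + of_real (2 * t * (1 - t)) * (p * c * f (A x y)) + of_real (t\<^sup>2) * (p * c\<^sup>2 * f (A y y))"
    unfolding z_def simps sym by (simp add: algebra_simps power2_eq_square)
  also have "p * f (A x x) = of_real (norm (f (A x x)))" by (simp add: p_def)
  also have "p * c * f (A x y) = of_real (norm (f (A x y)))" using p by (simp add: c_def)
  finally have eq: "of_real ((1 - t)\<^sup>2 * norm (f (A x x)) + 2 * t * (1 - t) * norm (f (A x y)))
      = p * f (A z z) - of_real (t\<^sup>2) * (p * c\<^sup>2 * f (A y y))"
    by simp
  have "(1 - t)\<^sup>2 * norm (f (A x x)) + 2 * t * (1 - t) * norm (f (A x y))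
      \<le> norm (of_real ((1 - t)\<^sup>2 * norm (f (A x x)) + 2 * t * (1 - t) * norm (f (A x y))) :: 'k)"
    unfolding norm_of_real by (rule abs_ge_self)
  also have "\<dots> \<le> norm (p * f (A z z)) + norm (of_real (t\<^sup>2) * (p * c\<^sup>2 * f (A y y)))"
    unfolding eq by (rule norm_triangle_ineq4)
  also have "\<dots> \<le> M + t\<^sup>2 * M"
    using M(1)[OF \<open>norm z \<le> 1\<close>] M(1)[OF y]
    by (intro add_mono) (simp_all add: norm_mult norm_power p c mult_left_mono)
  finally have 1: "(1 - t)\<^sup>2 * norm (f (A x x)) + 2 * t * (1 - t) * norm (f (A x y)) \<le> M + t\<^sup>2 * M" .
  have "(1 - t)\<^sup>2 * (M - 4 * R * t\<^sup>2) \<le> (1 - t)\<^sup>2 * norm (f (A x x))"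
    using near by (intro mult_left_mono) auto
  with 1 have "2 * t * ((1 - t) * norm (f (A x y))) \<le> 2 * t * (M + 2 * R * t * (1 - t)\<^sup>2)"
    by (simp add: algebra_simps power2_eq_square)
  then have 2: "(1 - t) * norm (f (A x y)) \<le> M + 2 * R * t * (1 - t)\<^sup>2"
    using t by simp
  have "0 \<le> R" using M(1)[OF x] M(2) norm_ge_zero[of "f (A x x)"] by linarith
  \<comment> \<open>Dividing by \<open>1 - t\<close> must not cost more than
    \<open>4 * R * t\<close>. This amounts to
    \<open>t * M + 2 * R * t * (1 - t)^2 \<le> 4 * R * t * (1 - t)\<close>, which follows from
    \<open>M \<le> R\<close> and \<open>t \<le> 1/4\<close>.\<close>
  have "t * M \<le> t * R" using t M by simp
  moreover have "R * t * (1 + 2 * (1 - t)\<^sup>2) \<le> R * t * (4 * (1 - t))"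
  proof (intro mult_left_mono)
    have "t * t \<le> 1/4 * (1/4)" using t by (intro mult_mono) auto
    then show "1 + 2 * (1 - t)\<^sup>2 \<le> 4 * (1 - t)"
      using t by (simp add: algebra_simps power2_eq_square)
  qed (use t \<open>0 \<le> R\<close> in simp)
  ultimately have "M + 2 * R * t * (1 - t)\<^sup>2 \<le> (1 - t) * (M + 4 * R * t)"
    by (simp add: algebra_simps)
  with 2 have "(1 - t) * norm (f (A x y)) \<le> (1 - t) * (M + 4 * R * t)" by simp
  then show ?thesis using t by simp
qed

text \<open>The functional \<open>G n\<close> of the overview. The phases make all summands
  nonnegative at \<open>u = x\<close>, and the factors \<open>2 ^ k\<close> turn a bounded total
  deficit into a deficit of order \<open>1 / 2 ^ k\<close> of the single term.\<close>

definition combined_functional ::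
  "nat \<Rightarrow> (nat \<Rightarrow> 'b \<Rightarrow> 'k) \<Rightarrow> ('a \<Rightarrow> 'a \<Rightarrow> 'b) \<Rightarrow> 'a \<Rightarrow> 'a \<Rightarrow> 'k" where
  "combined_functional n f A x u = (\<Sum>k<n. 2 ^ k * (phase (f k (A x x)) * f k (A x u)))"

text \<open>Chosen so that, with \<open>q n = 1 / 4 ^ Suc n\<close>, the product of the weight and
  the square of \<open>q n\<close> is \<open>8 * R * 2 ^ n\<close>. It outweighs the possible gain
  from the square of the combined functional.\<close>

definition weight :: "real \<Rightarrow> nat \<Rightarrow> real" where
  "weight R n = 8 * R * 2 ^ n * 16 ^ Suc n"

definition kernel ::
  "real \<Rightarrow> nat \<Rightarrow> (nat \<Rightarrow> 'b \<Rightarrow> 'k) \<Rightarrow> ('a \<Rightarrow> 'a \<Rightarrow> 'b) \<Rightarrow> 'a \<Rightarrow> 'a \<Rightarrow> 'a \<Rightarrow> 'k" where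
  "kernel R n f A x u v = of_real (weight R n) * (phase (f n (A x x)) * f n (A u v)) +
     combined_functional n f A x u * combined_functional n f A x v"

text \<open>The perturbation has the direction \<open>A x x\<close>; at \<open>(x, x)\<close>, where
  the kernel is real and nonnegative, it multiplies \<open>A x x\<close> by a factor of at least one
  if \<open>d\<close> is nonnegative.\<close>

definition perturb ::
  "real \<Rightarrow> real \<Rightarrow> nat \<Rightarrow> (nat \<Rightarrow> 'b \<Rightarrow> 'k) \<Rightarrow> ('a \<Rightarrow> 'a \<Rightarrow> 'b) \<Rightarrow> 'a \<Rightarrow> 'a \<Rightarrow> 'a \<Rightarrow> 'b" where
  "perturb R d n f A x u v = A u v + sY (of_real d * kernel R n f A x u v) (A x x)"

text \<open>The expression in parentheses bounds the kernel, the last factor \<open>R\<close> bounds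
  \<open>A x x\<close>.\<close>

definition perturb_bound :: "real \<Rightarrow> nat \<Rightarrow> real" where
  "perturb_bound R n = (weight R n * R + 4 ^ n * R\<^sup>2) * R"

text \<open>Needed for the recursive choice: step \<open>n\<close> must not depend on functionals
  chosen later.\<close>

lemma kernel_cong:
  assumes "\<And>k. k \<le> n \<Longrightarrow> f k = g k"
  shows "kernel R n f = kernel R n g"
  using assms by (auto simp: fun_eq_iff kernel_def combined_functional_def)

context
  fixes R :: real and f :: "nat \<Rightarrow> 'b \<Rightarrow> 'k" and A :: "'a \<Rightarrow> 'a \<Rightarrow> 'b" and x :: 'a and n :: nat
  assumes R: "1 \<le> R" and f: "\<And>k. k \<le> n \<Longrightarrow> f k \<in> dual_ball sY"
    and A: "bounded_symmetric sX sY R A" and x: "norm x \<le> 1"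
begin

lemma norm_form_le_bound: "k \<le> n \<Longrightarrow> norm (f k (A u v)) \<le> R * norm u * norm v"
  using norm_dual_ball_le[OF f] bounded_symmetricD(2)[OF A] order_trans by blast

lemma sum_powers_le: "(\<Sum>k<n. 2 ^ k * R) \<le> 2 ^ n * R"
proof -
  have "(\<Sum>k<m. 2 ^ k) = 2 ^ m - (1::real)" for m :: nat by (induction m) auto
  then show ?thesis unfolding sum_distrib_right [symmetric] using R by (simp add: mult_right_mono)
qed

lemma norm_combined_functional_le':
  "norm (combined_functional n f A x u) \<le> (\<Sum>k<n. 2 ^ k * norm (f k (A x u)))"
  unfolding combined_functional_def by (rule sum_norm_le) (simp add: norm_mult norm_power)

lemma norm_combined_functional_le: "norm (combined_functional n f A x u) \<le> 2 ^ n * R * norm u"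
proof -
  have "(\<Sum>k<n. 2 ^ k * norm (f k (A x u))) \<le> (\<Sum>k<n. 2 ^ k * R * norm u)"
  proof (rule sum_mono)
    fix k assume "k \<in> {..<n}"
    then have "norm (f k (A x u)) \<le> R * norm x * norm u" by (intro norm_form_le_bound) auto
    also have "\<dots> \<le> R * 1 * norm u" using x R by (intro mult_right_mono mult_left_mono) auto
    finally show "2 ^ k * norm (f k (A x u)) \<le> 2 ^ k * R * norm u" by simp
  qed
  also have "\<dots> \<le> 2 ^ n * R * norm u"
    unfolding sum_distrib_right [symmetric]
    by (intro mult_right_mono sum_powers_le[unfolded sum_distrib_right [symmetric]]) (use R in auto)
  finally show ?thesis using norm_combined_functional_le' order_trans by blast
qed

lemma norm_kernel_le: "norm (kernel R n f A x u v) \<le> (weight R n * R + 4 ^ n * R\<^sup>2) * norm u * norm v"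
proof -
  have w: "weight R n \<ge> 0" using R by (simp add: weight_def)
  have "norm (kernel R n f A x u v) \<le> weight R n * (R * norm u * norm v) +
      (2 ^ n * R * norm u) * (2 ^ n * R * norm v)"
    unfolding kernel_def
  proof (intro norm_triangle_le add_mono)
    show "norm (of_real (weight R n) * (phase (f n (A x x)) * f n (A u v))) \<le> weight R n * (R * norm u * norm v)"
      using w norm_form_le_bound[of n u v] by (simp add: norm_mult mult_left_mono)
    show "norm (combined_functional n f A x u * combined_functional n f A x v)
        \<le> (2 ^ n * R * norm u) * (2 ^ n * R * norm v)"
      unfolding norm_mult using R by (intro mult_mono norm_combined_functional_le) auto
  qed
  also have "\<dots> = (weight R n * R + (2 ^ n * 2 ^ n) * R\<^sup>2) * norm u * norm v"
    by (simp add: algebra_simps power2_eq_square)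
  also have "(2 ^ n * 2 ^ n :: real) = 4 ^ n" by (simp add: power_mult_distrib [symmetric])
  finally show ?thesis .
qed

lemma combined_functional_diag:
  "combined_functional n f A x x = of_real (\<Sum>k<n. 2 ^ k * norm (f k (A x x)))"
  by (simp add: combined_functional_def)

lemma kernel_diag:
  "kernel R n f A x x x = of_real (weight R n * norm (f n (A x x)) + (\<Sum>k<n. 2 ^ k * norm (f k (A x x)))\<^sup>2)"
  by (simp add: kernel_def combined_functional_diag power2_eq_square del: of_real_sum)

lemma norm_perturb_diff_le:
  assumes "0 \<le> d"
  shows "norm (perturb R d n f A x u v - A u v) \<le> d * perturb_bound R n * norm u * norm v"
proof -
  have "norm (perturb R d n f A x u v - A u v) = d * norm (kernel R n f A x u v) * norm (A x x)"
    using assms by (simp add: perturb_def Y.norm_scale norm_mult)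
  also have "\<dots> \<le> d * ((weight R n * R + 4 ^ n * R\<^sup>2) * norm u * norm v) * R"
    using assms R x norm_kernel_le norm_bounded_symmetric_le[OF A]
    by (intro mult_mono mult_left_mono) (auto simp: weight_def)
  finally show ?thesis by (simp add: perturb_bound_def algebra_simps)
qed

text \<open>Two bounds for \<open>A\<close> occur: the fixed \<open>R\<close> estimates the
  perturbation, and the possibly sharper \<open>C\<close> accumulates the increments.\<close>

lemma bounded_symmetric_perturb:
  assumes "0 \<le> d" and A': "bounded_symmetric sX sY C A"
  shows "bounded_symmetric sX sY (C + d * perturb_bound R n) (perturb R d n f A x)"
proof -
  note simps = bounded_symmetricD[OF A]
  have cf: "combined_functional n f A x (u + v) = combined_functional n f A x u + combined_functional n f A x v"
    "combined_functional n f A x (sX c u) = c * combined_functional n f A x u" for u v c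
    using form_simps[OF A dual_ballD(1)[OF f]]
    by (simp_all add: combined_functional_def sum.distrib [symmetric] sum_distrib_left algebra_simps)
  note fs = form_simps[OF A dual_ballD(1)[OF f[OF order_refl]]]
  have k_sym: "kernel R n f A x u v = kernel R n f A x v u" for u v
    using simps(1)[of u v] by (simp add: kernel_def)
  have k: "kernel R n f A x (u + u') v = kernel R n f A x u v + kernel R n f A x u' v"
    "kernel R n f A x (sX c u) v = c * kernel R n f A x u v" for u u' v c
    unfolding kernel_def cf fs by (simp_all add: algebra_simps)
  have p_sym: "perturb R d n f A x u v = perturb R d n f A x v u" for u v
    using simps(1)[of u v] k_sym[of u v] by (simp add: perturb_def)
  have p: "perturb R d n f A x (u + u') v = perturb R d n f A x u v + perturb R d n f A x u' v"
    "perturb R d n f A x (sX c u) v = sY c (perturb R d n f A x u v)" for u u' v c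
    unfolding perturb_def k simps(3,5)
    by (simp_all add: distrib_left Y.scale_left_distrib Y.scale_right_distrib mult.left_commute)
  have "bilinear_over sX sY (perturb R d n f A x)"
    by (intro bilinearI) (metis p p_sym)+
  moreover note p_sym
  moreover have "norm (perturb R d n f A x u v) \<le> (C + d * perturb_bound R n) * norm u * norm v" for u v
    using norm_triangle_sub[of "perturb R d n f A x u v" "A u v"] norm_perturb_diff_le[OF assms(1), of u v]
      bounded_symmetricD(2)[OF A', of u v]
    by (simp add: algebra_simps)
  ultimately show ?thesis unfolding bounded_symmetric_def by blast
qed

end

end

section \<open>The iteration\<close>

text \<open>\<open>A_0\<close> leaves room one for all perturbations together, and \<open>r\<close>
  will bound all suprema from below. The tolerance \<open>d n * t\<close> is small against the gain
  of step \<open>n\<close>, at least \<open>d n * r\<close> per unit of the kernel;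
  \<open>d_Suc\<close> makes the later changes small in the same sense.\<close>

locale perturbation_sequence = banach_pair sX sY
  for sX :: "'k::real_or_complex \<Rightarrow> 'a::banach \<Rightarrow> 'a"
    and sY :: "'k \<Rightarrow> 'b::banach \<Rightarrow> 'b" +
  fixes A :: "nat \<Rightarrow> 'a \<Rightarrow> 'a \<Rightarrow> 'b" and x :: "nat \<Rightarrow> 'a" and f :: "nat \<Rightarrow> 'b \<Rightarrow> 'k"
    and d :: "nat \<Rightarrow> real" and R r t :: real
  assumes x: "\<And>n. norm (x n) \<le> 1" and f: "\<And>n. f n \<in> dual_ball sY"
    and near: "\<And>n. poly_sup (A n) - d n * t \<le> norm (f n (A n (x n) (x n)))"
    and step: "\<And>n. A (Suc n) = perturb R (d n) n f (A n) (x n)"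
    and A_0: "bounded_symmetric sX sY (R - 1) (A 0)"
    and R: "1 \<le> R" and r: "0 < r" "2 * r \<le> poly_sup (A 0)"
    and t: "0 < t" "t \<le> 1" "5 * t \<le> r"
    and d_pos: "\<And>n. 0 < d n"
    and d_Suc: "\<And>n. d (Suc n) * perturb_bound R (Suc n) = d n * t / 32"
    and d_0: "d 0 * perturb_bound R 0 \<le> 1/32" "2 * (d 0 * perturb_bound R 0) \<le> r"
begin

section \<open>Sizes of the perturbations, with \<open>b n\<close> bounding the one of index
  \<open>n\<close>\<close>

definition b :: "nat \<Rightarrow> real" where
  "b n = d n * perturb_bound R n"

text \<open>The step length for \<open>norm_form_at_near_maximum\<close>: at most
  \<open>1/4\<close>, and still summable after multiplication by \<open>2 ^ n\<close>.\<close>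

definition q :: "nat \<Rightarrow> real" where
  "q n = 1 / 4 ^ Suc n"

lemma weight_ge_1: "1 \<le> weight R n"
proof -
  have "1 * 1 * 1 * 1 \<le> 8 * R * 2 ^ n * 16 ^ Suc n"
    using R by (intro mult_mono one_le_power) auto
  then show ?thesis by (simp add: weight_def)
qed

lemma weight_q: "weight R n * (q n)\<^sup>2 = 8 * R * 2 ^ n"
proof -
  have "(4 ^ Suc n)\<^sup>2 = (16 ^ Suc n :: real)"
    by (simp add: power2_eq_square power_mult_distrib [symmetric])
  then show ?thesis by (simp add: weight_def q_def power_divide)
qed

lemma perturb_bound_ge: "weight R n \<le> perturb_bound R n"
proof -
  have "weight R n * 1 * 1 \<le> (weight R n * R + 4 ^ n * R\<^sup>2) * R"
    using R weight_ge_1[of n] by (intro mult_mono add_increasing2 mult_left_mono) auto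
  then show ?thesis by (simp add: perturb_bound_def)
qed

lemma d_le_b: "d n \<le> b n" and d_weight_le_b: "weight R n * d n \<le> b n"
proof -
  show "weight R n * d n \<le> b n"
    using perturb_bound_ge[of n] d_pos[of n] by (simp add: b_def)
  moreover have "1 * d n \<le> weight R n * d n"
    using weight_ge_1[of n] d_pos[of n] by (intro mult_right_mono) auto
  ultimately show "d n \<le> b n" by simp
qed

lemma b_pos: "0 < b n"
  using d_le_b[of n] d_pos[of n] by linarith

lemma d_t_le: "d n * t \<le> b n"
proof -
  have "d n * t \<le> d n * 1" using t d_pos[of n] by (intro mult_left_mono) auto
  then show ?thesis using d_le_b[of n] by simp
qed

lemma b_Suc: "b (Suc n) = d n * t / 32" and b_Suc_le: "b (Suc n) \<le> b n / 32"
  using d_Suc[of n] d_t_le[of n] by (simp_all add: b_def)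

lemma b_le_power: "b n \<le> 1 / 32 ^ Suc n"
proof (induction n)
  case 0
  then show ?case using d_0 by (simp add: b_def)
next
  case (Suc n)
  then show ?case using b_Suc_le[of n] by simp
qed

text \<open>All changes from index \<open>n\<close> on add up to at most \<open>2 * b n\<close>, so
  they do not spoil near maximality up to the order of the square of \<open>q n\<close>.\<close>

lemma b_le_q: "2 * b n \<le> (q n)\<^sup>2"
proof -
  have "2 * 16 ^ Suc n \<le> (2::real) ^ Suc n * 16 ^ Suc n"
    by simp
  also have "\<dots> = 32 ^ Suc n" by (simp add: power_mult_distrib [symmetric])
  finally have "2 / 32 ^ Suc n \<le> 1 / (16::real) ^ Suc n" by (simp add: field_simps)
  moreover have "(q n)\<^sup>2 = 1 / 16 ^ Suc n"
    by (simp add: q_def power2_eq_square power_mult_distrib [symmetric])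
  ultimately show ?thesis using b_le_power[of n] by simp
qed

lemma b_decreasing: "n \<le> m \<Longrightarrow> b m \<le> b n"
proof (induction m rule: dec_induct)
  case (step m)
  then show ?case using b_Suc_le[of m] b_pos[of m] by simp
qed simp

lemma d_decreasing: "n \<le> m \<Longrightarrow> d m \<le> d n"
proof (induction m rule: dec_induct)
  case (step m)
  have "d m * t \<le> d m * 1" using t d_pos[of m] by (intro mult_left_mono) auto
  then show ?case using step.IH b_Suc[of m] d_le_b[of "Suc m"] d_pos[of m] by linarith
qed simp

lemma sum_b_le: "(\<Sum>i=n..<n + k. b i) \<le> 2 * b n"
proof (induction k arbitrary: n)
  case 0
  then show ?case using b_pos[of n] by simp
next
  case (Suc k)
  have "(\<Sum>i=n..<n + Suc k. b i) = b n + (\<Sum>i=Suc n..<Suc n + k. b i)"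
    by (simp add: sum.atLeast_Suc_lessThan)
  then show ?case using Suc.IH[of "Suc n"] b_Suc_le[of n] b_pos[of n] by simp
qed

lemma A_bounded: "bounded_symmetric sX sY R (A n)"
proof -
  \<comment> \<open>The accumulated bound is carried through the induction; it never exceeds
    \<open>R\<close>, as the \<open>b i\<close> sum to at most one.\<close>
  have "bounded_symmetric sX sY (R - 1 + (\<Sum>i=0..<n. b i)) (A n)"
  proof (induction n)
    case 0
    then show ?case using A_0 by simp
  next
    case (Suc n)
    have "(\<Sum>i=0..<n. b i) \<le> 1" using sum_b_le[of 0 n] b_le_power[of 0] by simp
    then have "bounded_symmetric sX sY R (A n)"
      by (intro bounded_symmetric_mono[OF Suc]) simp
    from bounded_symmetric_perturb[OF R f this x less_imp_le[OF d_pos] Suc]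
    show ?case by (simp add: step b_def add.assoc)
  qed
  then show ?thesis
    by (rule bounded_symmetric_mono) (use sum_b_le[of 0 n] b_le_power[of 0] in simp)
qed

lemma norm_A_diff_le:
  assumes "n \<le> m"
  shows "norm (A m u v - A n u v) \<le> 2 * b n * norm u * norm v"
proof -
  obtain k where m: "m = n + k" using assms le_Suc_ex by blast
  have "norm (A (n + k) u v - A n u v) \<le> (\<Sum>i=n..<n + k. b i) * (norm u * norm v)"
  proof (induction k)
    case 0
    then show ?case by simp
  next
    case (Suc k)
    have "norm (A (Suc (n + k)) u v - A (n + k) u v) \<le> b (n + k) * norm u * norm v"
      unfolding step b_def
      by (rule norm_perturb_diff_le[OF R f A_bounded x less_imp_le[OF d_pos]])
    then show ?case
      using Suc norm_triangle_ineq[of "A (Suc (n + k)) u v - A (n + k) u v" "A (n + k) u v - A n u v"]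
      by (simp add: algebra_simps)
  qed
  also have "\<dots> \<le> 2 * b n * (norm u * norm v)"
    by (intro mult_right_mono sum_b_le) auto
  finally show ?thesis by (simp add: m mult.assoc)
qed

lemma norm_A_diff_le_ball:
  assumes "n \<le> m" "norm u \<le> 1" "norm v \<le> 1"
  shows "norm (A m u v - A n u v) \<le> 2 * b n"
proof -
  have "2 * b n * norm u * norm v \<le> 2 * b n * 1 * 1"
    using assms b_pos[of n] by (intro mult_mono) auto
  then show ?thesis using norm_A_diff_le[OF assms(1), of u v] by simp
qed

lemma norm_f_A_diff_le:
  assumes "n \<le> m" "norm u \<le> 1" "norm v \<le> 1"
  shows "\<bar>norm (f k (A m u v)) - norm (f k (A n u v))\<bar> \<le> 2 * b n"
proof -
  have "\<bar>norm (f k (A m u v)) - norm (f k (A n u v))\<bar> \<le> norm (f k (A m u v) - f k (A n u v))"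
    by (rule norm_triangle_ineq3)
  also have "f k (A m u v) - f k (A n u v) = f k (A m u v - A n u v)"
    by (rule dual_diff[OF dual_ballD(1)[OF f], symmetric])
  also have "norm \<dots> \<le> norm (A m u v - A n u v)" by (rule norm_dual_ball_le[OF f])
  finally show ?thesis using norm_A_diff_le_ball[OF assms] by simp
qed

section \<open>The suprema of the successive maps\<close>

abbreviation M :: "nat \<Rightarrow> real" where
  "M n \<equiv> poly_sup (A n)"

lemma M_diff: "n \<le> m \<Longrightarrow> \<bar>M m - M n\<bar> \<le> 2 * b n"
  using poly_sup_diff[OF A_bounded, of "A m" n "2 * b n"] poly_sup_diff[OF A_bounded, of "A n" m "2 * b n"]
    norm_A_diff_le_ball[of n m]
  by (fastforce simp: norm_minus_commute abs_le_iff)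

lemma M_upper: "norm u \<le> 1 \<Longrightarrow> norm (f k (A n u u)) \<le> M n"
  by (rule poly_sup_upper[OF A_bounded f])

text \<open>The supremum starts at \<open>2 * r\<close> or more, and all changes together are at
  most \<open>2 * b 0 \<le> r\<close>.\<close>

lemma M_ge: "r \<le> M n"
  using M_diff[of 0 n] r d_0(2) by (simp add: b_def abs_le_iff)

lemma M_le: "M n \<le> R"
proof (rule poly_sup_least)
  fix g and u :: 'a assume "g \<in> dual_ball sY" "norm u \<le> 1"
  then show "norm (g (A n u u)) \<le> R"
    using norm_dual_ball_le[of g sY "A n u u"] norm_bounded_symmetric_le[OF A_bounded, of u u n] R
    by force
qed

section \<open>The kernel at later points\<close>

abbreviation h :: "nat \<Rightarrow> 'a \<Rightarrow> 'k" where
  "h n u \<equiv> kernel R n f (A n) (x n) u u"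

abbreviation S :: "nat \<Rightarrow> real" where
  "S n \<equiv> \<Sum>k<n. 2 ^ k * norm (f k (A n (x n) (x n)))"

abbreviation g :: "nat \<Rightarrow> 'a \<Rightarrow> real" where
  "g n u \<equiv> norm (combined_functional n f (A n) (x n) u)"

lemma S_nonneg: "0 \<le> S n"
  by (intro sum_nonneg) auto

lemma h_diag: "h n (x n) = of_real (weight R n * norm (f n (A n (x n) (x n))) + (S n)\<^sup>2)"
  by (rule kernel_diag[OF R f A_bounded x])

text \<open>
  The term of index \<open>n\<close> increases the supremum at \<open>x n\<close>, and all later changes are
  negligible; hence all later points \<open>x j\<close> have to benefit from it as well.
\<close>

lemma h_later_points:
  assumes "n < j"
  shows "weight R n * norm (f n (A n (x n) (x n))) + (S n)\<^sup>2 \<le> norm (h n (x j)) + 1"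
proof -
  let ?h = "weight R n * norm (f n (A n (x n) (x n))) + (S n)\<^sup>2"
  have h0: "0 \<le> ?h" using weight_ge_1[of n] by simp
  have "?h = norm (h n (x n))" unfolding h_diag norm_of_real using h0 by simp
  also have "\<dots> \<le> (weight R n * R + 4 ^ n * R\<^sup>2) * norm (x n) * norm (x n)"
    by (rule norm_kernel_le[OF R f A_bounded x])
  also have "\<dots> \<le> (weight R n * R + 4 ^ n * R\<^sup>2) * 1 * R"
    using R x[of n] weight_ge_1[of n] by (intro mult_mono) auto
  finally have "?h \<le> perturb_bound R n" by (simp add: perturb_bound_def)
  then have "d n * ?h \<le> b n" using d_pos[of n] by (simp add: b_def)
  then have dh: "d n * ?h \<le> 1" using b_le_power[of n] one_le_power[of "32::real" "Suc n"]
    by (smt (verit) divide_le_eq_1)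
  have val: "norm (k (A (Suc n) u u)) = norm (k (A n u u) + of_real (d n) * h n u * k (A n (x n) (x n)))"
    if "k \<in> dual_ball sY" for k u
    using dual_ballD(1)[OF that] by (simp add: step perturb_def dual_add dual_scale)
  \<comment> \<open>At \<open>x n\<close> the kernel equals the nonnegative real \<open>?h\<close>,
    so the perturbation multiplies the nearly maximal value by exactly
    \<open>1 + d n * ?h\<close>.\<close>
  have "(M n - d n * t) * (1 + d n * ?h) \<le> norm (f n (A n (x n) (x n))) * (1 + d n * ?h)"
    using near[of n] h0 d_pos[of n] by (intro mult_right_mono) auto
  also have "\<dots> = norm (of_real (1 + d n * ?h) * f n (A n (x n) (x n)))"
    using h0 d_pos[of n] by (simp add: norm_mult del: of_real_add of_real_mult)
  also have "\<dots> = norm (f n (A (Suc n) (x n) (x n)))"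
    unfolding val[OF f] h_diag by (simp add: algebra_simps)
  also have "\<dots> \<le> M (Suc n)" by (rule M_upper[OF x])
  finally have 1: "(M n - d n * t) * (1 + d n * ?h) \<le> M (Suc n)" .
  have "norm (f j (A (Suc n) (x j) (x j))) \<le> norm (f j (A n (x j) (x j))) + norm (of_real (d n) * h n (x j) * f j (A n (x n) (x n)))"
    unfolding val[OF f] by (rule norm_triangle_ineq)
  also have "\<dots> \<le> M n + d n * norm (h n (x j)) * M n"
    using d_pos[of n] M_upper[OF x, of j n]
    by (intro add_mono) (simp_all add: norm_mult x mult_left_mono)
  finally have 2: "norm (f j (A (Suc n) (x j) (x j))) \<le> M n + d n * norm (h n (x j)) * M n" .
  have 3: "\<bar>norm (f j (A j (x j) (x j))) - norm (f j (A (Suc n) (x j) (x j)))\<bar> \<le> 2 * b (Suc n)"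
    using assms by (intro norm_f_A_diff_le x) simp
  have 4: "\<bar>M j - M (Suc n)\<bar> \<le> 2 * b (Suc n)" using assms by (intro M_diff) simp
  have 5: "d j * t \<le> d n * t" using d_decreasing[of n j] assms t by simp
  have 6: "d n * t * (d n * ?h) \<le> d n * t * 1"
    using dh d_pos[of n] t by (intro mult_left_mono) auto
  \<comment> \<open>The errors are \<open>d n * t\<close> from near maximality at \<open>n\<close>,
    the same from its product with \<open>d n * ?h \<le> 1\<close>, the same from near maximality at
    \<open>j\<close>, and \<open>4 * b (Suc n)\<close> for passing between \<open>Suc n\<close> and
    \<open>j\<close>.\<close>
  have "M n * (d n * ?h) - M n * (d n * norm (h n (x j))) \<le> 2 * (d n * t) + d n * t + 4 * b (Suc n)"
    using 1 2 3 4 5 6 near[of j] by (simp add: algebra_simps abs_le_iff)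
  also have "\<dots> \<le> d n * (5 * t)" using d_pos[of n] t by (simp add: b_Suc)
  also have "\<dots> \<le> d n * r" using t d_pos[of n] by (intro mult_left_mono) auto
  finally have "d n * (M n * (?h - norm (h n (x j)))) \<le> d n * r" by (simp add: algebra_simps)
  then have *: "M n * (?h - norm (h n (x j))) \<le> r" using d_pos[of n] by simp
  show ?thesis
  proof (rule ccontr)
    assume "\<not> ?thesis"
    then have "r * 1 < M n * (?h - norm (h n (x j)))"
      using M_ge[of n] r by (intro mult_le_less_imp_less) auto
    then show False using * by simp
  qed
qed

lemma h_later_points':
  assumes "n < j"
  shows "weight R n * norm (f n (A n (x n) (x n))) + (S n)\<^sup>2
    \<le> weight R n * norm (f n (A n (x j) (x j))) + (g n (x j))\<^sup>2 + 1"
proof -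
  have "norm (h n (x j)) \<le> weight R n * norm (f n (A n (x j) (x j))) + (g n (x j))\<^sup>2"
    unfolding kernel_def using weight_ge_1[of n]
    by (intro norm_triangle_le) (simp add: norm_mult power2_eq_square)
  then show ?thesis using h_later_points[OF assms] by simp
qed

text \<open>Here \<open>q k\<close> must decay faster than \<open>1 / 2 ^ k\<close>: the weighted
  errors form a geometric series whose sum does not depend on \<open>n\<close>.\<close>

lemma sum_errors_le: "(\<Sum>k<n. 2 ^ k * (4 * R * q k + 4 * R * (q k)\<^sup>2)) \<le> 5/2 * R"
proof -
  have "(\<Sum>k<n. 2 ^ k * (4 * R * q k + 4 * R * (q k)\<^sup>2)) \<le> (\<Sum>k<n. 5/4 * R * (1/2) ^ k)"
  proof (rule sum_mono)
    fix k
    have "q k \<le> 1/4" "0 \<le> q k" by (simp_all add: q_def divide_le_eq)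
    then have "(q k)\<^sup>2 \<le> 1/4 * q k" unfolding power2_eq_square by (intro mult_right_mono)
    then have "4 * R * q k + 4 * R * (q k)\<^sup>2 \<le> 4 * R * q k + 4 * R * (1/4 * q k)"
      using R by (intro add_left_mono mult_left_mono) auto
    then have "2 ^ k * (4 * R * q k + 4 * R * (q k)\<^sup>2) \<le> 2 ^ k * (5 * R * q k)"
      by (intro mult_left_mono) auto
    also have "\<dots> = 5/4 * R * (2 ^ k / 4 ^ k)" by (simp add: q_def)
    also have "2 ^ k / 4 ^ k = (1/2::real) ^ k" by (simp add: power_divide [symmetric])
    finally show "2 ^ k * (4 * R * q k + 4 * R * (q k)\<^sup>2) \<le> 5/4 * R * (1/2) ^ k" .
  qed
  also have "\<dots> = 5/4 * R * (\<Sum>k<n. (1/2) ^ k)" by (simp add: sum_distrib_left)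
  also have "(\<Sum>k<n. (1/2) ^ k) \<le> (2::real)" by (simp add: sum_gp_strict)
  then have "5/4 * R * (\<Sum>k<n. (1/2) ^ k) \<le> 5/4 * R * 2" using R by (intro mult_left_mono) auto
  finally show ?thesis by simp
qed

section \<open>Stage \<open>n\<close>, given near maximality at all later points for every earlier
  index\<close>

context
  fixes n
  assumes earlier: "\<And>k j. k < n \<Longrightarrow> k < j \<Longrightarrow> M k - 2 * R * (q k)\<^sup>2 \<le> norm (f k (A k (x j) (x j)))"
begin

text \<open>Passing from \<open>A k\<close> to \<open>A n\<close> changes form and supremum by at
  most \<open>2 * b k\<close> each; \<open>b_le_q\<close> absorbs this by doubling the
  constant.\<close>

lemma earlier_at_diag:
  assumes "k < n"
  shows "M n - 4 * R * (q k)\<^sup>2 \<le> norm (f k (A n (x n) (x n)))"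
proof -
  have "\<bar>norm (f k (A n (x n) (x n))) - norm (f k (A k (x n) (x n)))\<bar> \<le> 2 * b k"
    using assms by (intro norm_f_A_diff_le x) simp
  moreover have "\<bar>M n - M k\<bar> \<le> 2 * b k" using assms by (intro M_diff) simp
  moreover have "1 * (q k)\<^sup>2 \<le> R * (q k)\<^sup>2" using R by (intro mult_right_mono) auto
  ultimately show ?thesis
    using earlier[OF assms assms] b_le_q[of k] by (simp add: abs_le_iff)
qed

text \<open>The derivative estimate with step length \<open>q k\<close>, for which
  \<open>earlier_at_diag\<close> is precisely the near maximality required.\<close>

lemma earlier_cap:
  assumes "k < n" "norm u \<le> 1"
  shows "norm (f k (A n (x n) u)) \<le> M n + 4 * R * q k"
  by (rule norm_form_at_near_maximum[OF A_bounded dual_ballD(1)[OF f] M_upper M_le x assms(2) _ _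
        earlier_at_diag[OF assms(1)]])
    (auto simp: q_def divide_le_eq)

text \<open>The error terms make each deficit nonnegative, so that a bound on a weighted sum of
  deficits bounds every single one.\<close>

lemma deficit_nonneg:
  assumes "k < n" "norm u \<le> 1"
  shows "0 \<le> norm (f k (A n (x n) (x n))) + (4 * R * q k + 4 * R * (q k)\<^sup>2) - norm (f k (A n (x n) u))"
  using earlier_at_diag[OF assms(1)] earlier_cap[OF assms] by simp

lemma g_le_sum: "g n u \<le> (\<Sum>k<n. 2 ^ k * norm (f k (A n (x n) u)))"
  by (rule norm_combined_functional_le'[OF R f A_bounded x])

lemma sum_deficits:
  "(\<Sum>k<n. 2 ^ k * (norm (f k (A n (x n) (x n))) + (4 * R * q k + 4 * R * (q k)\<^sup>2) - norm (f k (A n (x n) u))))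
    \<le> S n - g n u + 5/2 * R"
  using g_le_sum[of u] sum_errors_le[of n]
  by (simp add: algebra_simps sum.distrib sum_subtractf)

text \<open>Nonnegative deficits allow \<open>g n (x j)\<close> to exceed \<open>S n\<close> by at
  most \<open>5/2 * R\<close>, hence its square to exceed that of \<open>S n\<close> by a multiple
  of \<open>2 ^ n\<close>. By \<open>h_later_points'\<close> the weighted form can drop only by that
  much, and the weight makes this drop small.\<close>

lemma deficit_at_n:
  assumes "n < j"
  shows "M n - 2 * R * (q n)\<^sup>2 \<le> norm (f n (A n (x j) (x j)))"
proof -
  have le: "g n u \<le> 2 ^ n * R" if "norm u \<le> 1" for u
  proof -
    have "g n u \<le> 2 ^ n * R * norm u" by (rule norm_combined_functional_le[OF R f A_bounded x])
    also have "\<dots> \<le> 2 ^ n * R * 1" using that R by (intro mult_left_mono) auto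
    finally show ?thesis by simp
  qed
  have "S n = g n (x n)" using S_nonneg[of n] by (simp add: combined_functional_diag[OF R f A_bounded x] del: of_real_sum)
  then have S_le: "S n \<le> 2 ^ n * R" using le[OF x] by simp
  have "0 \<le> S n - g n (x j) + 5/2 * R"
    by (rule order_trans[OF sum_nonneg sum_deficits]) (use deficit_nonneg x in auto)
  then have "(g n (x j) - S n) * (g n (x j) + S n) \<le> 5/2 * R * (2 ^ n * R + 2 ^ n * R)"
    using S_le le[OF x, of j] S_nonneg[of n] R by (intro mult_mono add_mono) auto
  then have "(g n (x j))\<^sup>2 - (S n)\<^sup>2 \<le> 5 * R\<^sup>2 * 2 ^ n"
    by (simp add: algebra_simps power2_eq_square)
  moreover have "1 * 1 \<le> R\<^sup>2 * 2 ^ n" using R by (intro mult_mono one_le_power) auto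
  ultimately have "weight R n * (norm (f n (A n (x n) (x n))) - norm (f n (A n (x j) (x j)))) \<le> 8 * R\<^sup>2 * 2 ^ n"
    using h_later_points'[OF assms] by (simp add: algebra_simps)
  also have "\<dots> = weight R n * (R * (q n)\<^sup>2)"
    using weight_q[of n] by (simp add: algebra_simps power2_eq_square)
  finally have "norm (f n (A n (x n) (x n))) - norm (f n (A n (x j) (x j))) \<le> R * (q n)\<^sup>2"
    using weight_ge_1[of n] by simp
  moreover have "1 * (q n)\<^sup>2 \<le> R * (q n)\<^sup>2" using R by (intro mult_right_mono) auto
  ultimately show ?thesis using near[of n] d_t_le[of n] b_le_q[of n] b_pos[of n] by simp
qed

text \<open>Conversely, the weighted form gains at most \<open>b n \<le> 1\<close> at
  \<open>x j\<close>, so \<open>g n (x j)\<close> is at least \<open>S n - 2\<close>. The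
  nonnegative weighted deficits then sum to at most \<open>6 * R\<close>, and dividing one of them
  by \<open>2 ^ k\<close> gives the claim.\<close>

lemma deficit_cross:
  assumes "k < n" "n < j"
  shows "M n - 6 * R / 2 ^ k \<le> norm (f k (A n (x n) (x j)))"
proof -
  let ?e = "4 * R * q k + 4 * R * (q k)\<^sup>2"
  have "weight R n * norm (f n (A n (x j) (x j))) \<le> weight R n * (norm (f n (A n (x n) (x n))) + d n * t)"
    using near[of n] M_upper[OF x, of n n j] weight_ge_1[of n] by (intro mult_left_mono) auto
  moreover have "weight R n * (d n * t) \<le> weight R n * d n"
    using weight_ge_1[of n] d_pos[of n] t by simp
  moreover have "b n \<le> 1"
    using b_le_power[of 0] b_decreasing[of 0 n] by simp
  ultimately have sq: "(S n)\<^sup>2 \<le> (g n (x j))\<^sup>2 + 2"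
    using h_later_points'[OF assms(2)] d_weight_le_b[of n] by (simp add: algebra_simps)
  have "S n \<le> g n (x j) + 2"
  proof (rule power2_le_imp_le)
    have "(g n (x j) + 2)\<^sup>2 = (g n (x j))\<^sup>2 + 4 * g n (x j) + 4" by (simp add: power2_sum)
    moreover have "0 \<le> g n (x j)" by simp
    ultimately show "(S n)\<^sup>2 \<le> (g n (x j) + 2)\<^sup>2" using sq by linarith
  qed simp
  define D where "D k = 2 ^ k * (norm (f k (A n (x n) (x n))) + (4 * R * q k + 4 * R * (q k)\<^sup>2)
      - norm (f k (A n (x n) (x j))))" for k
  have "D k \<le> (\<Sum>l<n. D l)"
  proof (rule member_le_sum)
    show "0 \<le> D l" if "l \<in> {..<n} - {k}" for l
      unfolding D_def using that deficit_nonneg[OF _ x] by (intro mult_nonneg_nonneg) auto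
  qed (use assms(1) in auto)
  also have "(\<Sum>l<n. D l) \<le> 2 + 5/2 * R"
    using sum_deficits[of "x j"] \<open>S n \<le> g n (x j) + 2\<close> unfolding D_def by linarith
  also have "\<dots> \<le> 6 * R" using R by simp
  finally have "norm (f k (A n (x n) (x n))) + ?e - norm (f k (A n (x n) (x j))) \<le> 6 * R / 2 ^ k"
    by (simp add: D_def pos_le_divide_eq mult.commute)
  moreover have "0 \<le> 4 * R * q k" using R by (simp add: q_def)
  ultimately show ?thesis using earlier_at_diag[OF assms(1)] by simp
qed

end

text \<open>Strong induction on \<open>n\<close> discharges the assumption \<open>earlier\<close> of
  the stage.\<close>

lemma near_maximum_later:
  "n < j \<Longrightarrow> M n - 2 * R * (q n)\<^sup>2 \<le> norm (f n (A n (x j) (x j)))"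
proof (induction n arbitrary: j rule: less_induct)
  case (less n)
  show ?case by (rule deficit_at_n[OF less.IH less.prems])
qed

lemma cross_terms:
  "k < n \<Longrightarrow> n < j \<Longrightarrow> M n - 6 * R / 2 ^ k \<le> norm (f k (A n (x n) (x j)))"
  by (rule deficit_cross) (rule near_maximum_later)

subsection \<open>The limit\<close>

lemma b_LIMSEQ: "b \<longlonglongrightarrow> 0"
proof (rule tendsto_sandwich[of "\<lambda>_. 0" _ _ "\<lambda>n. (1/32) ^ n"])
  have "b n \<le> (1/32) ^ n" for n
  proof -
    have "1 / 32 ^ Suc n = (1/32) ^ n * (1/32 :: real)" by (simp add: power_divide)
    moreover have "0 \<le> (1/32 :: real) ^ n" by simp
    ultimately show ?thesis using b_le_power[of n] by linarith
  qed
  then show "\<forall>\<^sub>F n in sequentially. b n \<le> (1/32) ^ n" by simp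
qed (use b_pos in \<open>auto intro!: LIMSEQ_power_zero always_eventually simp: less_imp_le\<close>)

definition L :: "'a \<Rightarrow> 'a \<Rightarrow> 'b" where
  "L u v = lim (\<lambda>n. A n u v)"

lemma A_LIMSEQ: "(\<lambda>n. A n u v) \<longlonglongrightarrow> L u v"
proof -
  have lim: "(\<lambda>n. 2 * b n * norm u * norm v) \<longlonglongrightarrow> 0"
    using tendsto_mult_left[OF b_LIMSEQ, of "2 * norm u * norm v"] by (simp add: mult_ac)
  have "Cauchy (\<lambda>n. A n u v)"
  proof (rule CauchyI')
    fix e :: real assume "e > 0"
    then obtain N where N: "\<And>n. n \<ge> N \<Longrightarrow> 2 * b n * norm u * norm v < e"
      using order_tendstoD(2)[OF lim] unfolding eventually_sequentially by blast
    have "dist (A m u v) (A n u v) < e" if "m \<ge> N" "n > m" for m n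
      using norm_A_diff_le[of m n u v] N[OF that(1)] that by (simp add: dist_norm norm_minus_commute)
    then show "\<exists>N. \<forall>m\<ge>N. \<forall>n>m. dist (A m u v) (A n u v) < e" by blast
  qed
  then show ?thesis
    unfolding L_def using Cauchy_convergent_iff convergent_LIMSEQ_iff by blast
qed

lemma norm_L_diff_le: "norm (L u v - A n u v) \<le> 2 * b n * norm u * norm v"
proof (rule LIMSEQ_le_const2)
  show "(\<lambda>m. norm (A m u v - A n u v)) \<longlonglongrightarrow> norm (L u v - A n u v)"
    by (intro tendsto_intros A_LIMSEQ)
qed (use norm_A_diff_le in blast)

lemma L_bounded: "bounded_symmetric sX sY R L"
proof -
  note A = bounded_symmetricD[OF A_bounded]
  have sY_lim: "(\<lambda>n. sY c (A n u v)) \<longlonglongrightarrow> sY c (L u v)" for c u v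
  proof (rule Lim_null[THEN iffD2], rule Lim_null_comparison)
    show "\<forall>\<^sub>F n in sequentially. norm (sY c (A n u v) - sY c (L u v)) \<le> norm c * norm (A n u v - L u v)"
      by (simp add: Y.scale_right_diff_distrib [symmetric] Y.norm_scale)
    have "(\<lambda>n. norm c * norm (A n u v - L u v)) \<longlonglongrightarrow> norm c * norm (L u v - L u v)"
      by (intro tendsto_intros A_LIMSEQ)
    then show "(\<lambda>n. norm c * norm (A n u v - L u v)) \<longlonglongrightarrow> 0" by simp
  qed
  have sym: "L u v = L v u" for u v
    unfolding L_def using A(1) by metis
  have add: "L (u + u') v = L u v + L u' v" for u u' v
  proof (rule LIMSEQ_unique[OF A_LIMSEQ])
    show "(\<lambda>n. A n (u + u') v) \<longlonglongrightarrow> L u v + L u' v"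
      unfolding A(3) by (intro tendsto_intros A_LIMSEQ)
  qed
  have scale: "L (sX c u) v = sY c (L u v)" for c u v
    by (rule LIMSEQ_unique[OF A_LIMSEQ]) (simp add: A(5) sY_lim)
  have "bilinear_over sX sY L"
    by (intro bilinearI) (metis add scale sym)+
  moreover have "norm (L u v) \<le> R * norm u * norm v" for u v
    by (rule LIMSEQ_le_const2[OF tendsto_norm[OF A_LIMSEQ]]) (use A(2) in blast)
  ultimately show ?thesis unfolding bounded_symmetric_def using sym by blast
qed

lemma norm_L_diff_le_ball:
  assumes "norm u \<le> 1" "norm v \<le> 1"
  shows "norm (L u v - A n u v) \<le> 2 * b n"
proof -
  have "2 * b n * norm u * norm v \<le> 2 * b n * 1 * 1"
    using assms b_pos[of n] by (intro mult_mono) auto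
  then show ?thesis using norm_L_diff_le[of u v n] by simp
qed

text \<open>Replacing \<open>A i\<close> by \<open>L\<close> costs \<open>2 * b i\<close> in the
  supremum and in the form; as \<open>k < i\<close>, both together are at most
  \<open>R / 2 ^ k\<close>.\<close>

lemma cross_terms_limit:
  assumes "k < i" "i < j"
  shows "poly_sup L - 7 * R / 2 ^ k \<le> norm (f k (L (x i) (x j)))"
proof -
  have 1: "poly_sup L \<le> M i + 2 * b i"
    by (rule poly_sup_diff[OF A_bounded]) (rule norm_L_diff_le_ball)
  have "norm (f k (A i (x i) (x j)) - f k (L (x i) (x j))) \<le> norm (A i (x i) (x j) - L (x i) (x j))"
    using norm_dual_ball_le[OF f] by (simp add: dual_diff[OF dual_ballD(1)[OF f], symmetric])
  also have "\<dots> \<le> 2 * b i" using norm_L_diff_le_ball[OF x x] by (simp add: norm_minus_commute)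
  finally have 2: "norm (f k (A i (x i) (x j))) \<le> norm (f k (L (x i) (x j))) + 2 * b i"
    using norm_triangle_ineq2[of "f k (A i (x i) (x j))" "f k (L (x i) (x j))"] by simp
  have "4 * b i \<le> 4 * (1 / 32 ^ Suc k)"
    using b_decreasing[of k i] b_le_power[of k] assms by simp
  also have "\<dots> \<le> 1 / 2 ^ k"
  proof -
    have "(2::real) ^ k \<le> 32 ^ k" by (rule power_mono) auto
    also have "\<dots> \<le> 8 * 32 ^ k" by simp
    finally show ?thesis by (simp add: field_simps)
  qed
  also have "\<dots> \<le> R / 2 ^ k" using R by (intro divide_right_mono) auto
  finally show ?thesis using cross_terms[OF assms] 1 2 by (simp add: add_divide_distrib)
qed

lemma L_poly2: "(\<lambda>u. L u u) \<in> poly2 sX sY"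
proof -
  have "bdd_above ((\<lambda>u. norm (L u u)) ` cball 0 1)"
    by (rule bdd_aboveI2[where M = R]) (use norm_bounded_symmetric_le[OF L_bounded] R in auto)
  then show ?thesis
    using L_bounded by (auto simp: poly2_def bounded_symmetric_def)
qed

lemma L_attains: "aron_berner_attains_norm sX sY (\<lambda>u. L u u)"
proof -
  obtain F z where F: "F \<noteq> bot" "F \<le> sequentially" and z: "z \<in> bidual_ball sX"
    and zlim: "\<And>k. k \<in> dual sX \<Longrightarrow> ((\<lambda>n. k (x n)) \<longlongrightarrow> z k) F"
    by (rule X.bidual_cluster_point[of x, OF x]) blast
  have ev: "eventually (\<lambda>j. i < j) F" for i
    using eventually_gt_at_top[of i] F(2) by (simp add: filter_leD)
  have ge: "poly_sup L - 7 * R / 2 ^ k \<le> norm (z (\<lambda>u. z (\<lambda>v. f k (L u v))))" for k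
  proof -
    note fk = dual_ballD(1)[OF f, of k]
    \<comment> \<open>First \<open>j\<close> tends to \<open>z\<close> with \<open>i\<close> fixed,
      which is allowed because eventually \<open>i < j\<close> along \<open>F\<close>. Afterwards
      \<open>i\<close> tends to \<open>z\<close> in the functional that results.\<close>
    have 1: "poly_sup L - 7 * R / 2 ^ k \<le> norm (z (\<lambda>v. f k (L (x i) v)))" if "k < i" for i
      by (rule tendsto_lowerbound[OF tendsto_norm[OF zlim[OF form_dual[OF L_bounded fk]]] _ F(1)])
        (use ev[of i] cross_terms_limit[OF that] in \<open>auto elim: eventually_mono\<close>)
    show ?thesis
      by (rule tendsto_lowerbound[OF tendsto_norm[OF zlim[OF form_dual_bidual[OF L_bounded fk z]]] _ F(1)])
        (use ev[of k] 1 in \<open>auto elim: eventually_mono\<close>)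
  qed
  show ?thesis
  proof (rule aron_berner_attains_normI[OF L_poly2 _ L_bounded z])
    fix e :: real assume "e > 0"
    have "(\<lambda>k. 7 * R * (1/2) ^ k) \<longlonglongrightarrow> 7 * R * 0"
      by (intro tendsto_mult tendsto_const LIMSEQ_power_zero) simp
    then have "eventually (\<lambda>k. 7 * R * (1/2) ^ k < e) sequentially"
      using \<open>e > 0\<close> by (intro order_tendstoD(2)) auto
    then obtain k where "7 * R * (1/2) ^ k < e"
      by (auto simp: eventually_sequentially)
    then show "\<exists>f\<in>dual_ball sY. poly_sup L - e \<le> norm (z (\<lambda>x. z (\<lambda>y. f (L x y))))"
      using ge[of k] f[of k] by (intro bexI[of _ "f k"]) (auto simp: power_divide)
  qed simp
qed

end

section \<open>Existence of the sequence and density\<close>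

context banach_pair begin

text \<open>The pairs \<open>(x n, f n)\<close> enter as a parameter \<open>s\<close>, since each of
  them can be chosen only when the map at its stage is known.\<close>

primrec perturbed :: "real \<Rightarrow> (nat \<Rightarrow> real) \<Rightarrow> ('a \<Rightarrow> 'a \<Rightarrow> 'b) \<Rightarrow> (nat \<Rightarrow> 'a \<times> ('b \<Rightarrow> 'k)) \<Rightarrow>
    nat \<Rightarrow> 'a \<Rightarrow> 'a \<Rightarrow> 'b" where
  "perturbed R d B s 0 = B"
| "perturbed R d B s (Suc n) =
     perturb R (d n) n (\<lambda>k. snd (s k)) (perturbed R d B s n) (fst (s n))"

lemma perturbed_cong:
  "(\<And>k. k < n \<Longrightarrow> s k = s' k) \<Longrightarrow> perturbed R d B s n = perturbed R d B s' n"
proof (induction n)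
  case (Suc n)
  have "kernel R n (\<lambda>k. snd (s k)) = kernel R n (\<lambda>k. snd (s' k))"
    by (rule kernel_cong) (simp add: Suc.prems)
  then have "perturb R (d n) n (\<lambda>k. snd (s k)) = perturb R (d n) n (\<lambda>k. snd (s' k))"
    by (simp add: perturb_def [abs_def])
  then show ?case using Suc.IH Suc.prems by simp
qed simp

text \<open>Dependent choice along the natural numbers: by \<open>perturbed_cong\<close> the
  condition on the pair of index \<open>n\<close> involves only the earlier pairs.\<close>

lemma near_maximizers:
  assumes "\<And>n. 0 < e n"
  obtains x f where "\<And>n. norm (x n) \<le> 1" and "\<And>n. f n \<in> dual_ball sY"
    and "\<And>n. poly_sup (perturbed R d B (\<lambda>n. (x n, f n)) n) - e n
      \<le> norm (f n (perturbed R d B (\<lambda>n. (x n, f n)) n (x n) (x n)))"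
proof -
  define N where "N s n p \<longleftrightarrow> norm (fst p) \<le> 1 \<and> snd p \<in> dual_ball sY \<and>
    poly_sup (perturbed R d B s n) - e n \<le> norm (snd p (perturbed R d B s n (fst p) (fst p)))" for s n p
  have "\<exists>s. \<forall>n. N s n (s n)"
  proof (rule dependent_wellorder_choice)
    fix p and s s' :: "nat \<Rightarrow> 'a \<times> ('b \<Rightarrow> 'k)" and n :: nat
    assume "\<And>k. k < n \<Longrightarrow> s k = s' k"
    then show "N s n p = N s' n p" unfolding N_def by (simp add: perturbed_cong[of n s s'])
  next
    fix n :: nat and s :: "nat \<Rightarrow> 'a \<times> ('b \<Rightarrow> 'k)"
    obtain g u where "g \<in> dual_ball sY" "norm u \<le> 1"
        "norm (g (perturbed R d B s n u u)) > poly_sup (perturbed R d B s n) - e n"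
      using poly_sup_approx[OF assms] .
    then have "N s n (u, g)" by (simp add: N_def)
    then show "\<exists>p. N s n p" ..
  qed
  then obtain s where s: "\<And>n. N s n (s n)" by blast
  show ?thesis
    by (rule that[of "\<lambda>n. fst (s n)" "\<lambda>n. snd (s n)"]) (use s in \<open>simp_all add: N_def\<close>)
qed

text \<open>Polarization: \<open>B x y\<close> is the difference of the values of the polynomial at
  half the sum and half the difference of \<open>x\<close> and \<open>y\<close>, both in the
  ball.\<close>

lemma bounded_symmetric_sym_bilinear:
  assumes P: "P \<in> poly2 sX sY" and B: "bilinear_over sX sY B" and sym: "\<And>x y. B x y = B y x"
    and PB: "\<And>x. P x = B x x"
  obtains C where "0 \<le> C" "bounded_symmetric sX sY C B"
proof -
  note B = bilinearD[OF B]
  obtain c where c: "\<And>x. norm x \<le> 1 \<Longrightarrow> norm (B x x) \<le> c"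
  proof -
    obtain c where "\<forall>a\<in>(\<lambda>x. norm (P x)) ` cball 0 1. a \<le> c"
      using P unfolding poly2_def bdd_above_def by blast
    then show ?thesis using that[of c] by (simp add: PB)
  qed
  have c0: "0 \<le> c" using c[of 0] norm_ge_zero[of "B 0 0"] by (simp del: norm_ge_zero)
  have scaleR: "B (r *\<^sub>R x) y = r *\<^sub>R B x y" "B x (r *\<^sub>R y) = r *\<^sub>R B x y" for r x y
    by (simp_all add: X.scale_of_real [symmetric] Y.scale_of_real [symmetric] B)
  have ball: "norm (B x y) \<le> 2 * c" if "norm x \<le> 1" "norm y \<le> 1" for x y
  proof -
    define p where "p = (1/2) *\<^sub>R (x + y)"
    define m where "m = (1/2) *\<^sub>R (x + (-1) *\<^sub>R y)"
    have "norm p \<le> 1" "norm m \<le> 1"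
      using norm_triangle_ineq[of x y] norm_triangle_ineq4[of x y] that by (simp_all add: p_def m_def)
    moreover have "B x y = B p p - B m m"
      unfolding p_def m_def B scaleR sym[of y x]
      by (simp add: algebra_simps scaleR_add_left [symmetric])
    ultimately show ?thesis
      using c[of p] c[of m] norm_triangle_ineq4[of "B p p" "B m m"] by simp
  qed
  have "norm (B x y) \<le> 2 * c * norm x * norm y" for x y
  proof (cases "x = 0 \<or> y = 0")
    case True
    then show ?thesis using scaleR(1)[of 0 0 y] scaleR(2)[of x 0 0] by auto
  next
    case False
    have "norm (B ((1 / norm x) *\<^sub>R x) ((1 / norm y) *\<^sub>R y)) \<le> 2 * c"
      by (rule ball) (use False in auto)
    then show ?thesis using False unfolding scaleR by (simp add: field_simps)
  qed
  then have "bounded_symmetric sX sY (2 * c) B"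
    using assms by (simp add: bounded_symmetric_def)
  then show ?thesis using that[of "2 * c"] c0 by simp
qed

lemma dense_attaining:
  assumes P: "P \<in> poly2 sX sY" and "0 < \<epsilon>"
  shows "\<exists>Q\<in>poly2 sX sY. aron_berner_attains_norm sX sY Q \<and> poly2_norm (\<lambda>x. P x - Q x) < \<epsilon>"
proof -
  obtain B where B: "bilinear_over sX sY B" "\<And>x y. B x y = B y x" and PB: "\<And>x. P x = B x x"
    using sym_bilinear_ex1[OF X.banach_over_axioms Y.banach_over_axioms P] by blast
  obtain C where C: "0 \<le> C" "bounded_symmetric sX sY C B"
    using bounded_symmetric_sym_bilinear[OF P B PB] .
  show ?thesis
  proof (cases "poly_sup B \<le> 0")
    case True
    \<comment> \<open>With a supremum of at most zero, any point of the bidual ball and the zero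
      functional serve, so \<open>P\<close> itself attains its norm.\<close>
    obtain z where z: "z \<in> bidual_ball sX"
      by (rule X.bidual_cluster_point[of "\<lambda>_. 0"]) auto
    have "aron_berner_attains_norm sX sY P"
    proof (rule aron_berner_attains_normI[OF P PB C(2) z])
      fix e :: real assume "e > 0"
      then have "poly_sup B - e \<le> norm (z (\<lambda>x. z (\<lambda>y. 0)))"
        using True norm_ge_zero order_trans by (metis diff_le_0_iff_le less_imp_le)
      then show "\<exists>f\<in>dual_ball sY. poly_sup B - e \<le> norm (z (\<lambda>x. z (\<lambda>y. f (B x y))))"
        using Y.zero_in_dual_ball by (intro bexI[of _ "\<lambda>_. 0"]) auto
    qed
    moreover have "poly2_norm (\<lambda>x. P x - P x) = 0" by (simp add: poly2_norm_def)
    ultimately show ?thesis using P \<open>0 < \<epsilon>\<close> by auto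
  next
    case False
    \<comment> \<open>\<open>b0\<close> is the size of the first perturbation. Its three bounds give
      the geometric decay its start, keep the suprema above \<open>r\<close>, and keep the limit at
      distance at most \<open>2 * b0 < \<epsilon>\<close> from \<open>P\<close>.\<close>
    define R where "R = C + 1"
    define r where "r = poly_sup B / 2"
    define t where "t = min 1 (r / 5)"
    define b0 where "b0 = min (1/32) (min (r / 2) (\<epsilon> / 4))"
    have pos: "0 < r" "0 < t" "0 < b0" using False \<open>0 < \<epsilon>\<close> by (simp_all add: r_def t_def b0_def)
    have pb: "0 < perturb_bound R n" for n
    proof -
      have "0 < R" using C(1) by (simp add: R_def)
      then show ?thesis
        unfolding perturb_bound_def weight_def by (intro mult_pos_pos add_pos_pos) auto
    qed
    \<comment> \<open>The recursion solves the equation \<open>d_Suc\<close> of the iteration for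
      the next coefficient.\<close>
    define d where "d = rec_nat (b0 / perturb_bound R 0) (\<lambda>n c. c * t / (32 * perturb_bound R (Suc n)))"
    have d_start: "d 0 * perturb_bound R 0 = b0" using pb[of 0] by (simp add: d_def)
    have d_Suc: "d (Suc n) * perturb_bound R (Suc n) = d n * t / 32" for n
      using pb[of "Suc n"] by (simp add: d_def)
    have d_pos: "0 < d n" for n
      by (induction n) (use pos pb in \<open>simp_all add: d_def\<close>)
    have dt: "0 < d n * t" for n using d_pos pos by simp
    obtain x f where x: "\<And>n. norm (x n) \<le> 1" and f: "\<And>n. f n \<in> dual_ball sY"
      and near: "\<And>n. poly_sup (perturbed R d B (\<lambda>n. (x n, f n)) n) - d n * t
        \<le> norm (f n (perturbed R d B (\<lambda>n. (x n, f n)) n (x n) (x n)))"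
      by (rule near_maximizers[where e = "\<lambda>n. d n * t", OF dt]) blast
    interpret perturbation_sequence sX sY "perturbed R d B (\<lambda>n. (x n, f n))" x f d R r t
    proof
      show "2 * (d 0 * perturb_bound R 0) \<le> r" "d 0 * perturb_bound R 0 \<le> 1/32"
        unfolding d_start by (auto simp: b0_def)
    qed (use x f near C pos d_Suc d_pos in \<open>auto simp: R_def r_def t_def\<close>)
    have "b 0 = b0" by (simp add: b_def d_start)
    have "poly2_norm (\<lambda>x. P x - L x x) \<le> 2 * b0"
      unfolding poly2_norm_def
    proof (rule cSUP_least)
      fix u :: 'a assume "u \<in> cball 0 1"
      then show "norm (P u - L u u) \<le> 2 * b0"
        using norm_L_diff_le_ball[of u u 0] \<open>b 0 = b0\<close> by (simp add: PB norm_minus_commute)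
    qed simp
    also have "\<dots> < \<epsilon>" using \<open>0 < \<epsilon>\<close> by (auto simp: b0_def min_def)
    finally show ?thesis using L_attains L_poly2 by blast
  qed
qed

end

theorem theorem5p5:
  fixes sX :: "'k::real_or_complex \<Rightarrow> 'a::banach \<Rightarrow> 'a"
    and sY :: "'k \<Rightarrow> 'b::banach \<Rightarrow> 'b"
  assumes "banach_over sX" and "banach_over sY"
  shows "\<forall>P\<in>poly2 sX sY. \<forall>\<epsilon>>0. \<exists>Q\<in>poly2 sX sY.
           aron_berner_attains_norm sX sY Q \<and> poly2_norm (\<lambda>x. P x - Q x) < \<epsilon>"
proof -
  interpret banach_pair sX sY
    using assms by (simp add: banach_pair_def)
  show ?thesis using dense_attaining by blast
qed

end
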